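(* Let $(M,F)$ be a generalized P-reducible Finsler manifold, with $L_{ijk}=\lambda C_{ijk}+a_ih_{jk}+a_jh_{ki}+a_kh_{ij}$, and suppose that $F$ is of non-zero scalar flag curvature $\mathbf{K}=\mathbf{K}(x,y)$. Suppose that $\lambda'+\lambda^2+\mathbf{K}F^2\neq 0$ on $TM_0$, where $\lambda'=\lambda_{|l}y^l$. Then $F$ is a C-reducible metric.
   Context: Let $M$ be an $n$-dimensional $C^\infty$ manifold and $TM_0=TM\setminus\{0\}$ its slit tangent bundle, with standard coordinates $(x^i,y^i)$. Repeated indices are summed. A Finsler metric on $M$ is a function $F:TM\to[0,\infty)$ that is $C^\infty$ on $TM_0$, positively 1-homogeneous on the fibers, and such that $g_{ij}(x,y)=\frac12\frac{\partial^2F^2}{\partial y^i\partial y^j}$ is positive definite for every $y\neq0$. Let $(g^{ij})$ be the inverse of $(g_{ij})$; indices are raised and lowered with $g$. Put $y_i=g_{ij}y^j$. The angular metric is $h_{ij}=g_{ij}-F^{-2}y_iy_j$. The Cartan torsion is $C_{ijk}=\frac12\frac{\partial g_{ij}}{\partial y^k}$ and the mean Cartan torsion is $I_i=g^{jk}C_{ijk}$. The spray coefficients are $G^i=\frac14g^{il}\left(\frac{\partial^2F^2}{\partial x^k\partial y^l}y^k-\frac{\partial F^2}{\partial x^l}\right)$. The symbol "$|$" denotes horizontal covariant derivative with respect to the Berwald connection: with $\frac{\delta}{\delta x^m}=\frac{\partial}{\partial x^m}-\frac{\partial G^s}{\partial y^m}\frac{\partial}{\partial y^s}$ and $G^i_{jk}=\frac{\partial^2G^i}{\partial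 y^j\partial y^k}$, one has $f_{|m}=\frac{\delta f}{\delta x^m}$ for functions $f$ on $TM_0$, $T_{i|m}=\frac{\delta T_i}{\delta x^m}-T_sG^s_{im}$, $T^i{}_{|m}=\frac{\delta T^i}{\delta x^m}+T^sG^i_{sm}$, and similarly for tensors of higher rank. The Landsberg curvature is $L_{ijk}=C_{ijk|s}y^s$. $F$ is generalized P-reducible if $L_{ijk}=\lambda C_{ijk}+a_ih_{jk}+a_jh_{ki}+a_kh_{ij}$, where $\lambda=\lambda(x,y)$ is a scalar function on $TM_0$ positively homogeneous of degree 1 in $y$, and $a_i=a_i(x,y)$ is positively homogeneous of degree 0 in $y$ with $a_iy^i=0$. The Riemann curvature is $K^i{}_k=2\frac{\partial G^i}{\partial x^k}-y^j\frac{\partial^2G^i}{\partial x^j\partial y^k}+2G^j\frac{\partial^2G^i}{\partial y^j\partial y^k}-\frac{\partial G^i}{\partial y^j}\frac{\partial G^j}{\partial y^k}$, giving for each $y\in T_xM\setminus\{0\}$ a linear map $\mathbf{K}_y$ on $T_xM$. For a plane $P=\mathrm{span}\{y,u\}\subset T_xM$ the flag curvature is $\mathbf{K}(P,y)=\frac{\mathbf{g}_y(u,\mathbf{K}_y(u))}{\mathbf{g}_y(y,y)\mathbf{g}_y(u,u)-\mathbf{g}_y(y,u)^2}$, where $\mathbf{g}_y(u,v)=g_{ij}(x,y)u^iv^j$. $F$ is of scalar flag curvature if $\mathbf{K}(P,y)=\mathbf{K}(x,y)$ does not depend on $P$, i.e. is a scalar function on $TM_0$. $F$ is C-reducible if the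 Matsumoto torsion $M_{ijk}=C_{ijk}-\frac1{n+1}(I_ih_{jk}+I_jh_{ik}+I_kh_{ij})$ vanishes identically on $TM_0$. *)

theory Defs
  imports "HOL-Analysis.Analysis"
begin

section \<open>Smooth maps and smooth manifolds\<close>

text \<open>Only meant for open \<open>S\<close>: the derivatives are two-sided.\<close>

fun Ck_on :: "nat \<Rightarrow> ('a::real_normed_vector \<Rightarrow> 'b::real_normed_vector) \<Rightarrow> 'a set \<Rightarrow> bool" where
  "Ck_on 0 f S \<longleftrightarrow> continuous_on S f"
| "Ck_on (Suc k) f S \<longleftrightarrow> (\<forall>x\<in>S. f differentiable (at x)) \<and>
     (\<forall>v. Ck_on k (\<lambda>x. frechet_derivative f (at x) v) S)"

definition smooth_on :: "('a::real_normed_vector \<Rightarrow> 'b::real_normed_vector) \<Rightarrow> 'a set \<Rightarrow> bool" where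
  "smooth_on f S \<longleftrightarrow> (\<forall>k. Ck_on k f S)"

text \<open>A chart is a pair of its domain and its coordinate map; the dimension of the
  manifold is \<open>CARD('n)\<close>.\<close>

type_synonym ('m, 'n) chart = "'m set \<times> ('m \<Rightarrow> real^'n)"

definition chart_inv :: "('m, 'n::finite) chart \<Rightarrow> real^'n \<Rightarrow> 'm" where
  "chart_inv c = inv_into (fst c) (snd c)"

definition transition :: "('m, 'n::finite) chart \<Rightarrow> ('m, 'n) chart \<Rightarrow> real^'n \<Rightarrow> real^'n" where
  "transition c d = (\<lambda>x. snd d (chart_inv c x))"

definition chart_on :: "'m topology \<Rightarrow> ('m, 'n::finite) chart \<Rightarrow> bool" where
  "chart_on X c \<longleftrightarrow> openin X (fst c) \<and> open (snd c ` fst c) \<and>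
     homeomorphic_map (subtopology X (fst c)) (top_of_set (snd c ` fst c)) (snd c)"

definition smooth_manifold :: "'m topology \<Rightarrow> ('m, 'n::finite) chart set \<Rightarrow> bool" where
  "smooth_manifold X A \<longleftrightarrow>
     Hausdorff_space X \<and> second_countable X \<and>
     (\<forall>c\<in>A. chart_on X c) \<and> (\<Union>c\<in>A. fst c) = topspace X \<and>
     (\<forall>c\<in>A. \<forall>d\<in>A. smooth_on (transition c d) (snd c ` (fst c \<inter> fst d)))"

section \<open>The tangent bundle\<close>

text \<open>A tangent vector is a base point together with the family of its components in all
  charts of the atlas around that point, related by the Jacobians of the transition maps.
  Components in irrelevant charts are normalised to 0, so that equality of tangent vectors
  is equality in HOL.\<close>

type_synonym ('m, 'n) tvec = "'m \<times> (('m, 'n) chart \<Rightarrow> real^'n)"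

definition tangent_bundle :: "('m, 'n::finite) chart set \<Rightarrow> ('m, 'n) tvec set" where
  "tangent_bundle A = {(q, v). (\<exists>c\<in>A. q \<in> fst c) \<and>
     (\<forall>c\<in>A. \<forall>d\<in>A. q \<in> fst c \<inter> fst d \<longrightarrow>
        v d = frechet_derivative (transition c d) (at (snd c q)) (v c)) \<and>
     (\<forall>c. c \<notin> A \<or> q \<notin> fst c \<longrightarrow> v c = 0)}"

definition slit_tangent_bundle :: "('m, 'n::finite) chart set \<Rightarrow> ('m, 'n) tvec set" where
  "slit_tangent_bundle A = {(q, v) \<in> tangent_bundle A. \<exists>c. v c \<noteq> 0}"

text \<open>The tangent vector with standard coordinates \<open>(x, y)\<close> induced by the chart \<open>c\<close>.\<close>

definition tangent_vec ::
    "('m, 'n::finite) chart set \<Rightarrow> ('m, 'n) chart \<Rightarrow> (real^'n) \<times> (real^'n) \<Rightarrow> ('m, 'n) tvec" where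
  "tangent_vec A c p = (chart_inv c (fst p),
     \<lambda>d. if d \<in> A \<and> chart_inv c (fst p) \<in> fst d
         then frechet_derivative (transition c d) (at (fst p)) (snd p) else 0)"

lemma chart_inv_apply:
  assumes "chart_on X c" "q \<in> fst c"
  shows "chart_inv c (snd c q) = q"
proof -
  have "inj_on (snd c) (topspace (subtopology X (fst c)))"
    using assms(1) by (auto simp: chart_on_def homeomorphic_eq_everything_map)
  moreover have "topspace (subtopology X (fst c)) = fst c"
    using assms(1) openin_subset unfolding chart_on_def by fastforce
  ultimately show ?thesis
    using assms(2) by (simp add: chart_inv_def)
qed

lemma open_overlap:
  assumes "chart_on X c" "chart_on X d"
  shows "open (snd c ` (fst c \<inter> fst d))"
proof -
  have o: "openin (subtopology X (fst c)) (fst c \<inter> fst d)"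
    using assms by (auto simp: chart_on_def openin_subtopology_Int2)
  have "open_map (subtopology X (fst c)) (top_of_set (snd c ` fst c)) (snd c)"
    using assms(1) by (simp add: chart_on_def homeomorphic_eq_everything_map)
  then have "openin (top_of_set (snd c ` fst c)) (snd c ` (fst c \<inter> fst d))"
    using o by (simp add: open_map_def)
  then show ?thesis
    using assms(1) by (metis chart_on_def openin_open_eq)
qed

lemma transition_differentiable:
  assumes "smooth_manifold X A" "c \<in> A" "d \<in> A" "q \<in> fst c" "q \<in> fst d"
  shows "transition c d differentiable (at (snd c q))"
proof -
  have "Ck_on (Suc 0) (transition c d) (snd c ` (fst c \<inter> fst d))"
    using assms(1-3) unfolding smooth_manifold_def smooth_on_def by blast
  then show ?thesis using assms(4,5) by auto
qed

lemma transition_cocycle: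
  assumes M: "smooth_manifold X A" and "c \<in> A" "d \<in> A" "e \<in> A"
    and q: "q \<in> fst c" "q \<in> fst d" "q \<in> fst e"
  shows "frechet_derivative (transition c e) (at (snd c q)) y =
    frechet_derivative (transition d e) (at (snd d q))
      (frechet_derivative (transition c d) (at (snd c q)) y)"
proof -
  have ch: "chart_on X c" "chart_on X d" "chart_on X e"
    using assms by (auto simp: smooth_manifold_def)
  have cd: "transition c d (snd c q) = snd d q"
    using ch q by (simp add: transition_def chart_inv_apply)
  have 1: "(transition c d has_derivative frechet_derivative (transition c d) (at (snd c q)))
      (at (snd c q))"
    using transition_differentiable[OF M] assms frechet_derivative_works by blast
  have 2: "(transition d e has_derivative frechet_derivative (transition d e) (at (snd d q)))
      (at (snd d q))"
    using transition_differentiable[OF M] assms frechet_derivative_works by blast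
  have 3: "((transition d e \<circ> transition c d) has_derivative
      (frechet_derivative (transition d e) (at (snd d q)) \<circ>
       frechet_derivative (transition c d) (at (snd c q)))) (at (snd c q))"
    by (rule diff_chain_at[OF 1]) (use 2 cd in simp)
  have "(transition c e has_derivative
      (frechet_derivative (transition d e) (at (snd d q)) \<circ>
       frechet_derivative (transition c d) (at (snd c q)))) (at (snd c q))"
  proof (rule has_derivative_transform_within_open[OF 3 open_overlap[OF ch(1,2)]])
    show "snd c q \<in> snd c ` (fst c \<inter> fst d)" using q by auto
    fix x assume "x \<in> snd c ` (fst c \<inter> fst d)"
    then show "(transition d e \<circ> transition c d) x = transition c e x"
      using ch by (auto simp: transition_def chart_inv_apply)
  qed
  from fun_cong[OF frechet_derivative_at[OF this], of y] show ?thesis by simp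
qed

lemma tangent_vec_components:
  assumes M: "smooth_manifold X A" and "c \<in> A" "q \<in> fst c"
  shows "fst (tangent_vec A c (snd c q, y)) = q" "snd (tangent_vec A c (snd c q, y)) c = y"
proof -
  have ch: "chart_on X c" using assms by (auto simp: smooth_manifold_def)
  then show "fst (tangent_vec A c (snd c q, y)) = q"
    using assms by (simp add: tangent_vec_def chart_inv_apply)
  have "open (snd c ` fst c)" using ch by (simp add: chart_on_def)
  moreover have "transition c c x = x" if "x \<in> snd c ` fst c" for x
    using that ch by (auto simp: transition_def chart_inv_apply)
  ultimately have "(transition c c has_derivative (\<lambda>x. x)) (at (snd c q))"
    using assms(3)
    by (intro has_derivative_transform_within_open[OF has_derivative_ident]) auto
  then have "frechet_derivative (transition c c) (at (snd c q)) y = y"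
    using frechet_derivative_at fun_cong by metis
  then show "snd (tangent_vec A c (snd c q, y)) c = y"
    using assms ch by (simp add: tangent_vec_def chart_inv_apply)
qed

lemma tangent_bundle_eq:
  assumes M: "smooth_manifold X A"
  shows "tangent_bundle A = {tangent_vec A c (x, y) | c x y. c \<in> A \<and> x \<in> snd c ` fst c}"
proof (intro set_eqI iffI)
  fix w assume w: "w \<in> tangent_bundle A"
  then obtain q v c where c: "w = (q, v)" "c \<in> A" "q \<in> fst c"
    by (auto simp: tangent_bundle_def)
  have "chart_on X c" using M c by (auto simp: smooth_manifold_def)
  then have inv: "chart_inv c (snd c q) = q" using c(3) by (rule chart_inv_apply)
  have "v d = (if d \<in> A \<and> q \<in> fst d
      then frechet_derivative (transition c d) (at (snd c q)) (v c) else 0)" for d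
  proof (cases "d \<in> A \<and> q \<in> fst d")
    case True
    then have "v d = frechet_derivative (transition c d) (at (snd c q)) (v c)"
      using w c unfolding tangent_bundle_def by blast
    then show ?thesis by (simp only: True simp_thms if_True)
  next
    case False
    then have "v d = 0" using w c unfolding tangent_bundle_def by blast
    then show ?thesis by (simp only: False if_False)
  qed
  then have "w = tangent_vec A c (snd c q, v c)"
    unfolding tangent_vec_def c(1) fst_conv snd_conv inv by (intro arg_cong2[of _ _ _ _ Pair] refl ext)
  then show "w \<in> {tangent_vec A c (x, y) | c x y. c \<in> A \<and> x \<in> snd c ` fst c}"
    using c by blast
next
  fix w assume "w \<in> {tangent_vec A c (x, y) | c x y. c \<in> A \<and> x \<in> snd c ` fst c}"
  then obtain c q y where c: "w = tangent_vec A c (snd c q, y)" "c \<in> A" "q \<in> fst c"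
    by blast
  have "chart_on X c" using M c by (auto simp: smooth_manifold_def)
  then have inv: "chart_inv c (snd c q) = q" using c(3) by (rule chart_inv_apply)
  define v where "v = (\<lambda>d. if d \<in> A \<and> q \<in> fst d
    then frechet_derivative (transition c d) (at (snd c q)) y else 0)"
  have w: "w = (q, v)"
    unfolding c(1) tangent_vec_def fst_conv snd_conv inv v_def ..
  have "v e = frechet_derivative (transition d e) (at (snd d q)) (v d)"
    if "d \<in> A" "e \<in> A" "q \<in> fst d \<inter> fst e" for d e
    using transition_cocycle[OF M c(2) that(1,2) c(3), of y] that by (simp add: v_def)
  moreover have "v d = 0" if "d \<notin> A \<or> q \<notin> fst d" for d
    using that by (auto simp: v_def)
  ultimately show "w \<in> tangent_bundle A"
    using c(2,3) unfolding w tangent_bundle_def by blast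
qed

text \<open>Coordinate representation of a function on the tangent bundle, and the coordinate
  image of the slit tangent bundle over a chart.\<close>

definition coord :: "('m, 'n::finite) chart set \<Rightarrow> ('m, 'n) chart \<Rightarrow> (('m, 'n) tvec \<Rightarrow> 'b)
    \<Rightarrow> (real^'n) \<times> (real^'n) \<Rightarrow> 'b" where
  "coord A c f = (\<lambda>p. f (tangent_vec A c p))"

definition slit_dom :: "('m, 'n::finite) chart \<Rightarrow> ((real^'n) \<times> (real^'n)) set" where
  "slit_dom c = (snd c ` fst c) \<times> (UNIV - {0})"

section \<open>Finsler geometry in standard coordinates\<close>

text \<open>From here on \<open>F\<close> is the coordinate representation of a Finsler metric and
  \<open>p = (x, y)\<close>.\<close>

type_synonym 'n fn = "(real^'n) \<times> (real^'n) \<Rightarrow> real"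

definition dx :: "'n::finite \<Rightarrow> 'n fn \<Rightarrow> 'n fn" where
  "dx i f = (\<lambda>p. frechet_derivative f (at p) (axis i 1, 0))"

definition dy :: "'n::finite \<Rightarrow> 'n fn \<Rightarrow> 'n fn" where
  "dy i f = (\<lambda>p. frechet_derivative f (at p) (0, axis i 1))"

definition fund :: "'n::finite fn \<Rightarrow> 'n \<Rightarrow> 'n \<Rightarrow> 'n fn" where
  "fund F i j = (\<lambda>p. 1/2 * dy j (dy i (\<lambda>q. (F q)\<^sup>2)) p)"

definition fund_inv :: "'n::finite fn \<Rightarrow> 'n \<Rightarrow> 'n \<Rightarrow> 'n fn" where
  "fund_inv F i j = (\<lambda>p. matrix_inv ((\<chi> k l. fund F k l p) :: real^'n^'n) $ i $ j)"

definition y_low :: "'n::finite fn \<Rightarrow> 'n \<Rightarrow> 'n fn" where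
  "y_low F i = (\<lambda>p. \<Sum>j\<in>UNIV. fund F i j p * snd p $ j)"

definition angular :: "'n::finite fn \<Rightarrow> 'n \<Rightarrow> 'n \<Rightarrow> 'n fn" where
  "angular F i j = (\<lambda>p. fund F i j p - y_low F i p * y_low F j p / (F p)\<^sup>2)"

definition cartan :: "'n::finite fn \<Rightarrow> 'n \<Rightarrow> 'n \<Rightarrow> 'n \<Rightarrow> 'n fn" where
  "cartan F i j k = (\<lambda>p. 1/2 * dy k (fund F i j) p)"

definition mean_cartan :: "'n::finite fn \<Rightarrow> 'n \<Rightarrow> 'n fn" where
  "mean_cartan F i = (\<lambda>p. \<Sum>j\<in>UNIV. \<Sum>k\<in>UNIV. fund_inv F j k p * cartan F i j k p)"

definition matsumoto :: "'n::finite fn \<Rightarrow> 'n \<Rightarrow> 'n \<Rightarrow> 'n \<Rightarrow> 'n fn" where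
  "matsumoto F i j k = (\<lambda>p. cartan F i j k p - 1 / (real CARD('n) + 1) *
     (mean_cartan F i p * angular F j k p + mean_cartan F j p * angular F i k p
      + mean_cartan F k p * angular F i j p))"

definition spray :: "'n::finite fn \<Rightarrow> 'n \<Rightarrow> 'n fn" where
  "spray F i = (\<lambda>p. 1/4 * (\<Sum>l\<in>UNIV. fund_inv F i l p *
     ((\<Sum>k\<in>UNIV. dx k (dy l (\<lambda>q. (F q)\<^sup>2)) p * snd p $ k) - dx l (\<lambda>q. (F q)\<^sup>2) p)))"

definition berwald :: "'n::finite fn \<Rightarrow> 'n \<Rightarrow> 'n \<Rightarrow> 'n \<Rightarrow> 'n fn" where
  "berwald F i j k = dy k (dy j (spray F i))"

text \<open>\<open>\<delta>/\<delta>x\<^sup>m\<close>, which is also the horizontal derivative \<open>f\<^sub>|\<^sub>m\<close> of a function \<open>f\<close>.\<close>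

definition delta :: "'n::finite fn \<Rightarrow> 'n \<Rightarrow> 'n fn \<Rightarrow> 'n fn" where
  "delta F m f = (\<lambda>p. dx m f p - (\<Sum>s\<in>UNIV. dy m (spray F s) p * dy s f p))"

definition hderiv_cov3 ::
    "'n::finite fn \<Rightarrow> ('n \<Rightarrow> 'n \<Rightarrow> 'n \<Rightarrow> 'n fn) \<Rightarrow> 'n \<Rightarrow> 'n \<Rightarrow> 'n \<Rightarrow> 'n \<Rightarrow> 'n fn" where
  "hderiv_cov3 F T i j k m = (\<lambda>p. delta F m (T i j k) p
     - (\<Sum>s\<in>UNIV. T s j k p * berwald F s i m p)
     - (\<Sum>s\<in>UNIV. T i s k p * berwald F s j m p)
     - (\<Sum>s\<in>UNIV. T i j s p * berwald F s k m p))"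

definition landsberg :: "'n::finite fn \<Rightarrow> 'n \<Rightarrow> 'n \<Rightarrow> 'n \<Rightarrow> 'n fn" where
  "landsberg F i j k = (\<lambda>p. \<Sum>s\<in>UNIV. hderiv_cov3 F (cartan F) i j k s p * snd p $ s)"

definition riemann :: "'n::finite fn \<Rightarrow> 'n \<Rightarrow> 'n \<Rightarrow> 'n fn" where
  "riemann F i k = (\<lambda>p. 2 * dx k (spray F i) p
     - (\<Sum>j\<in>UNIV. snd p $ j * dx j (dy k (spray F i)) p)
     + 2 * (\<Sum>j\<in>UNIV. spray F j p * dy j (dy k (spray F i)) p)
     - (\<Sum>j\<in>UNIV. dy j (spray F i) p * dy k (spray F j) p))"

definition riemann_map ::
    "'n::finite fn \<Rightarrow> (real^'n) \<times> (real^'n) \<Rightarrow> real^'n \<Rightarrow> real^'n" where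
  "riemann_map F p u = (\<chi> i. \<Sum>k\<in>UNIV. riemann F i k p * u $ k)"

definition fund_form ::
    "'n::finite fn \<Rightarrow> (real^'n) \<times> (real^'n) \<Rightarrow> real^'n \<Rightarrow> real^'n \<Rightarrow> real" where
  "fund_form F p u v = (\<Sum>i\<in>UNIV. \<Sum>j\<in>UNIV. fund F i j p * u $ i * v $ j)"

text \<open>The flag curvature of the flag with pole \<open>y = snd p\<close> and plane \<open>span {y, u}\<close>.\<close>

definition flag_curvature :: "'n::finite fn \<Rightarrow> (real^'n) \<times> (real^'n) \<Rightarrow> real^'n \<Rightarrow> real" where
  "flag_curvature F p u = fund_form F p u (riemann_map F p u) /
     (fund_form F p (snd p) (snd p) * fund_form F p u u - (fund_form F p (snd p) u)\<^sup>2)"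

section \<open>Finsler manifolds\<close>

definition pos_homogeneous ::
    "('m, 'n::finite) chart set \<Rightarrow> nat \<Rightarrow> (('m, 'n) tvec \<Rightarrow> real) \<Rightarrow> bool" where
  "pos_homogeneous A r f \<longleftrightarrow> (\<forall>c\<in>A. \<forall>x\<in>snd c ` fst c. \<forall>y t. y \<noteq> 0 \<and> t > 0 \<longrightarrow>
     coord A c f (x, t *\<^sub>R y) = t ^ r * coord A c f (x, y))"

text \<open>Homogeneity at the zero vector amounts to the vanishing of \<open>F\<close> there.\<close>

definition finsler_metric :: "('m, 'n::finite) chart set \<Rightarrow> (('m, 'n) tvec \<Rightarrow> real) \<Rightarrow> bool" where
  "finsler_metric A F \<longleftrightarrow>
     (\<forall>w\<in>tangent_bundle A. F w \<ge> 0) \<and>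
     (\<forall>c\<in>A. smooth_on (coord A c F) (slit_dom c)) \<and>
     pos_homogeneous A 1 F \<and> (\<forall>c\<in>A. \<forall>x\<in>snd c ` fst c. coord A c F (x, 0) = 0) \<and>
     (\<forall>c\<in>A. \<forall>p\<in>slit_dom c. \<forall>u. u \<noteq> 0 \<longrightarrow> fund_form (coord A c F) p u u > 0)"

text \<open>A covector field along the slit tangent bundle is a map \<open>a\<close> such that, for a nonzero
  tangent vector \<open>w\<close> at \<open>q\<close>, \<open>a w\<close> is a linear form on the tangent space at \<open>q\<close>.\<close>

definition covector_field ::
    "('m, 'n::finite) chart set \<Rightarrow> (('m, 'n) tvec \<Rightarrow> ('m, 'n) tvec \<Rightarrow> real) \<Rightarrow> bool" where
  "covector_field A a \<longleftrightarrow> (\<forall>c\<in>A. \<forall>p\<in>slit_dom c.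
     linear (\<lambda>u. a (tangent_vec A c p) (tangent_vec A c (fst p, u))))"

definition coord_cov :: "('m, 'n::finite) chart set \<Rightarrow> ('m, 'n) chart
    \<Rightarrow> (('m, 'n) tvec \<Rightarrow> ('m, 'n) tvec \<Rightarrow> real) \<Rightarrow> 'n \<Rightarrow> 'n fn" where
  "coord_cov A c a i = (\<lambda>p. a (tangent_vec A c p) (tangent_vec A c (fst p, axis i 1)))"

definition generalized_P_reducible ::
    "('m, 'n::finite) chart set \<Rightarrow> (('m, 'n) tvec \<Rightarrow> real) \<Rightarrow> (('m, 'n) tvec \<Rightarrow> real)
     \<Rightarrow> (('m, 'n) tvec \<Rightarrow> ('m, 'n) tvec \<Rightarrow> real) \<Rightarrow> bool" where
  "generalized_P_reducible A F lam a \<longleftrightarrow>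
     pos_homogeneous A 1 lam \<and>
     covector_field A a \<and>
     (\<forall>c\<in>A. \<forall>x\<in>snd c ` fst c. \<forall>y t i. y \<noteq> 0 \<and> t > 0 \<longrightarrow>
        coord_cov A c a i (x, t *\<^sub>R y) = coord_cov A c a i (x, y)) \<and>
     (\<forall>c\<in>A. \<forall>p\<in>slit_dom c. (\<Sum>i\<in>UNIV. coord_cov A c a i p * snd p $ i) = 0) \<and>
     (\<forall>c\<in>A. \<forall>p\<in>slit_dom c. \<forall>i j k.
        landsberg (coord A c F) i j k p =
          coord A c lam p * cartan (coord A c F) i j k p
          + coord_cov A c a i p * angular (coord A c F) j k p
          + coord_cov A c a j p * angular (coord A c F) k i p
          + coord_cov A c a k p * angular (coord A c F) i j p)"

definition scalar_flag_curvature ::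
    "('m, 'n::finite) chart set \<Rightarrow> (('m, 'n) tvec \<Rightarrow> real) \<Rightarrow> (('m, 'n) tvec \<Rightarrow> real) \<Rightarrow> bool" where
  "scalar_flag_curvature A F K \<longleftrightarrow>
     (\<forall>c\<in>A. \<forall>p\<in>slit_dom c. \<forall>u. u \<notin> span {snd p} \<longrightarrow>
        flag_curvature (coord A c F) p u = coord A c K p)"

definition C_reducible :: "('m, 'n::finite) chart set \<Rightarrow> (('m, 'n) tvec \<Rightarrow> real) \<Rightarrow> bool" where
  "C_reducible A F \<longleftrightarrow>
     (\<forall>c\<in>A. \<forall>p\<in>slit_dom c. \<forall>i j k. matsumoto (coord A c F) i j k p = 0)"

end

theory Submission
  imports Defs
begin

text \<open>
  Write \<open>D\<close> for the covariant derivative along the spray, so that \<open>L = D C\<close>. Differentiating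
  \<open>D g = 0\<close> vertically gives \<open>g\<^sub>i\<^sub>j\<^sub>|\<^sub>k = -2 L\<^sub>i\<^sub>j\<^sub>k\<close>; applying \<open>D\<close> once more and commuting \<open>D\<close> with the
  horizontal derivative expresses \<open>D L\<^sub>i\<^sub>j\<^sub>k + C\<^sub>i\<^sub>j\<^sub>s R\<^sup>s\<^sub>k\<close> through vertical derivatives of the Riemann
  curvature. For scalar flag curvature \<open>R\<^sup>s\<^sub>k = K F\<^sup>2 h\<^sup>s\<^sub>k\<close>, and this becomes
  \<open>D L + K F\<^sup>2 C = - F\<^sup>2/3 (K\<^sub>i h\<^sub>j\<^sub>k + K\<^sub>j h\<^sub>k\<^sub>i + K\<^sub>k h\<^sub>i\<^sub>j)\<close>. On the other hand \<open>D h = 0\<close>, so applying \<open>D\<close> to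
  \<open>L = \<lambda> C + a h + a h + a h\<close> gives \<open>D L = (\<lambda>' + \<lambda>\<^sup>2) C\<close> modulo terms \<open>b\<^sub>i h\<^sub>j\<^sub>k + b\<^sub>j h\<^sub>k\<^sub>i + b\<^sub>k h\<^sub>i\<^sub>j\<close>.
  Hence \<open>(\<lambda>' + \<lambda>\<^sup>2 + K F\<^sup>2) C\<close> is of that form, so \<open>C\<close> is, and taking the trace identifies the
  covector as \<open>I / (n + 1)\<close>.
\<close>

section \<open>Smooth functions and directional derivatives\<close>

text \<open>A derivative at a point depends only on the values nearby, so on an open set agreement
  of two functions passes to their derivatives of every order.\<close>

lemma Ck_on_cong:
  assumes "open S" "\<And>x. x \<in> S \<Longrightarrow> f x = g x"
  shows "Ck_on k f S \<longleftrightarrow> Ck_on k g S"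
  using assms(2)
proof (induction k arbitrary: f g)
  case 0
  then show ?case by (auto intro: continuous_on_eq)
next
  case (Suc k)
  have dif: "f differentiable (at x) \<longleftrightarrow> g differentiable (at x)" if "x \<in> S" for x
    using Suc.prems \<open>open S\<close> that has_derivative_transform_within_open[of f _ x UNIV S g]
      has_derivative_transform_within_open[of g _ x UNIV S f]
    unfolding differentiable_def by fastforce
  have "Ck_on k (\<lambda>x. frechet_derivative f (at x) v) S \<longleftrightarrow>
      Ck_on k (\<lambda>x. frechet_derivative g (at x) v) S" if f: "\<forall>x\<in>S. f differentiable (at x)" for v
  proof (rule Suc.IH)
    fix x assume "x \<in> S"
    then have "frechet_derivative f (at x) = frechet_derivative g (at x)"
      using f Suc.prems by (intro frechet_derivative_transform_within_open[OF _ \<open>open S\<close>]) auto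
    then show "frechet_derivative f (at x) v = frechet_derivative g (at x) v" by simp
  qed
  then show ?case using dif by auto
qed

lemma Ck_on_transform:
  assumes "open S" "Ck_on k g S" "\<And>x. x \<in> S \<Longrightarrow> f x = g x"
  shows "Ck_on k f S"
  using assms(2) Ck_on_cong[OF assms(1,3)] by simp

lemma Ck_on_SucD: "Ck_on (Suc k) f S \<Longrightarrow> Ck_on k f S"
proof (induction k arbitrary: f)
  case 0
  then show ?case
    by (simp add: differentiable_imp_continuous_within continuous_at_imp_continuous_on)
next
  case (Suc k)
  then show ?case unfolding Ck_on.simps(2)[of "Suc k"] Ck_on.simps(2)[of k f] by blast
qed

lemma smooth_on_cong:
  assumes "open S" "\<And>x. x \<in> S \<Longrightarrow> f x = g x"
  shows "smooth_on f S \<longleftrightarrow> smooth_on g S"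
  unfolding smooth_on_def by (intro all_cong1 Ck_on_cong assms)

lemma smooth_on_differentiable: "smooth_on f S \<Longrightarrow> x \<in> S \<Longrightarrow> f differentiable (at x)"
  unfolding smooth_on_def using Ck_on.simps(2) by blast

lemma smooth_on_continuous: "smooth_on f S \<Longrightarrow> continuous_on S f"
  unfolding smooth_on_def using Ck_on.simps(1) by blast

lemma smooth_on_frechet_derivative:
  "smooth_on f S \<Longrightarrow> smooth_on (\<lambda>x. frechet_derivative f (at x) v) S"
  unfolding smooth_on_def using Ck_on.simps(2) by blast

lemma smooth_on_const [simp]: "smooth_on (\<lambda>x. c) S"
proof -
  have "Ck_on k (\<lambda>x. c) S" for k and c :: 'b
    by (induction k arbitrary: c) auto
  then show ?thesis by (simp add: smooth_on_def)
qed

lemma smooth_on_bounded_linear: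
  assumes "bounded_linear f"
  shows "smooth_on f S"
proof -
  have d: "(f has_derivative f) (at x)" for x
    using assms by (rule bounded_linear_imp_has_derivative)
  have d': "frechet_derivative f (at x) v = f v" for x v
    using frechet_derivative_at[OF d] by metis
  have "Ck_on k f S" for k
  proof (cases k)
    case 0
    then show ?thesis
      using assms by (simp add: linear_continuous_on)
  next
    case (Suc j)
    have "Ck_on j (\<lambda>x. f v) S" for v
      using smooth_on_const unfolding smooth_on_def by blast
    then show ?thesis
      using d unfolding Suc Ck_on.simps d' differentiable_def by blast
  qed
  then show ?thesis by (simp add: smooth_on_def)
qed

definition dir_deriv ::
    "'a::real_normed_vector \<Rightarrow> ('a \<Rightarrow> 'b::real_normed_vector) \<Rightarrow> 'a \<Rightarrow> 'b" where
  "dir_deriv v f p = frechet_derivative f (at p) v"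

lemma smooth_on_dir_deriv: "smooth_on f S \<Longrightarrow> smooth_on (dir_deriv v f) S"
  using smooth_on_frechet_derivative[of f S v] by (simp add: dir_deriv_def[abs_def])

lemma dir_deriv_cong:
  assumes "open S" "p \<in> S" "\<And>x. x \<in> S \<Longrightarrow> f x = g x" "g differentiable (at p)"
  shows "dir_deriv v f p = dir_deriv v g p"
  using frechet_derivative_transform_within_open[OF assms(4,1,2), of f] assms(3)
  by (metis dir_deriv_def)

lemma dir_deriv_const [simp]: "dir_deriv v (\<lambda>x. c) p = 0"
  by (simp add: dir_deriv_def)

lemma has_derivative_dir_deriv:
  "f differentiable (at p) \<Longrightarrow> (f has_derivative (\<lambda>v. dir_deriv v f p)) (at p)"
  unfolding dir_deriv_def using frechet_derivative_works by metis

lemma dir_deriv_eq: "(f has_derivative f') (at p) \<Longrightarrow> dir_deriv v f p = f' v"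
  unfolding dir_deriv_def using frechet_derivative_at by metis

lemma dir_deriv_add:
  assumes "f differentiable (at p)" "g differentiable (at p)"
  shows "dir_deriv v (\<lambda>x. f x + g x) p = dir_deriv v f p + dir_deriv v g p"
  by (rule dir_deriv_eq, intro has_derivative_add has_derivative_dir_deriv assms)

lemma dir_deriv_diff:
  assumes "f differentiable (at p)" "g differentiable (at p)"
  shows "dir_deriv v (\<lambda>x. f x - g x) p = dir_deriv v f p - dir_deriv v g p"
  by (rule dir_deriv_eq, intro has_derivative_diff has_derivative_dir_deriv assms)

lemma dir_deriv_mult:
  fixes f g :: "'a::real_normed_vector \<Rightarrow> real"
  assumes "f differentiable (at p)" "g differentiable (at p)"
  shows "dir_deriv v (\<lambda>x. f x * g x) p = f p * dir_deriv v g p + dir_deriv v f p * g p"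
  by (rule dir_deriv_eq, intro has_derivative_mult has_derivative_dir_deriv assms)

lemma dir_deriv_divide:
  fixes f g :: "'a::real_normed_vector \<Rightarrow> real"
  assumes "f differentiable (at p)" "g differentiable (at p)" "g p \<noteq> 0"
  shows "dir_deriv v (\<lambda>x. f x / g x) p = (dir_deriv v f p * g p - f p * dir_deriv v g p) / (g p * g p)"
  by (rule dir_deriv_eq, intro has_derivative_divide' has_derivative_dir_deriv assms)

lemma dir_deriv_sum:
  assumes "\<And>i. i \<in> I \<Longrightarrow> f i differentiable (at p)"
  shows "dir_deriv v (\<lambda>x. \<Sum>i\<in>I. f i x) p = (\<Sum>i\<in>I. dir_deriv v (f i) p)"
  by (rule dir_deriv_eq, intro has_derivative_sum has_derivative_dir_deriv assms)

section \<open>Closure of smooth functions under algebraic operations\<close>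

lemma Ck_on_add:
  assumes "open S"
  shows "Ck_on k f S \<Longrightarrow> Ck_on k g S \<Longrightarrow> Ck_on k (\<lambda>x. f x + g x) S"
proof (induction k arbitrary: f g)
  case 0
  then show ?case by (simp add: continuous_on_add)
next
  case (Suc k)
  have "Ck_on k (\<lambda>x. frechet_derivative (\<lambda>x. f x + g x) (at x) v) S" for v
  proof -
    have "Ck_on k (\<lambda>x. frechet_derivative f (at x) v + frechet_derivative g (at x) v) S"
      using Suc by auto
    moreover have "frechet_derivative (\<lambda>x. f x + g x) (at x) v =
        frechet_derivative f (at x) v + frechet_derivative g (at x) v" if "x \<in> S" for x
      using dir_deriv_add[of f x g v] Suc.prems that by (simp add: dir_deriv_def)
    ultimately show ?thesis by (rule Ck_on_transform[OF assms])
  qed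
  then show ?case using Suc.prems by (simp add: differentiable_add)
qed

lemma Ck_on_mult:
  fixes f g :: "'a::real_normed_vector \<Rightarrow> real"
  assumes "open S"
  shows "Ck_on k f S \<Longrightarrow> Ck_on k g S \<Longrightarrow> Ck_on k (\<lambda>x. f x * g x) S"
proof (induction k arbitrary: f g)
  case 0
  then show ?case by (simp add: continuous_on_mult)
next
  case (Suc k)
  have "Ck_on k (\<lambda>x. frechet_derivative (\<lambda>x. f x * g x) (at x) v) S" for v
  proof -
    \<comment> \<open>The product rule mixes the functions themselves, of class
      \<open>Suc k\<close>, with derivatives of class \<open>k\<close>; \<open>Ck_on_SucD\<close>
      brings all factors to class \<open>k\<close>.\<close>
    have "Ck_on k (\<lambda>x. f x * frechet_derivative g (at x) v + frechet_derivative f (at x) v * g x) S"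
      using Suc.prems by (intro Ck_on_add[OF assms] Suc.IH Ck_on_SucD[OF Suc.prems(1)]
          Ck_on_SucD[OF Suc.prems(2)]) auto
    moreover have "frechet_derivative (\<lambda>x. f x * g x) (at x) v =
        f x * frechet_derivative g (at x) v + frechet_derivative f (at x) v * g x" if "x \<in> S" for x
      using dir_deriv_mult[of f x g v] Suc.prems that by (simp add: dir_deriv_def)
    ultimately show ?thesis by (rule Ck_on_transform[OF assms])
  qed
  then show ?case using Suc.prems by (simp add: differentiable_mult)
qed

lemma Ck_on_inverse:
  fixes f :: "'a::real_normed_vector \<Rightarrow> real"
  assumes "open S" "\<And>x. x \<in> S \<Longrightarrow> f x \<noteq> 0"
  shows "Ck_on k f S \<Longrightarrow> Ck_on k (\<lambda>x. 1 / f x) S"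
proof (induction k)
  case 0
  then show ?case using assms by (simp add: continuous_on_divide)
next
  case (Suc k)
  have dif: "(\<lambda>x. 1 / f x) differentiable (at x)" if "x \<in> S" for x
    using Suc.prems that assms(2) by (auto intro!: differentiable_divide)
  have "Ck_on k (\<lambda>x. frechet_derivative (\<lambda>x. 1 / f x) (at x) v) S" for v
  proof -
    \<comment> \<open>The derivative of \<open>1 / f\<close> is written as a product in which
      \<open>1 / f\<close> itself occurs twice, so that the induction hypothesis applies to these
      factors.\<close>
    have "Ck_on k (\<lambda>x. ((-1) * frechet_derivative f (at x) v) * ((1 / f x) * (1 / f x))) S"
      using smooth_on_const[of "-1" S, unfolded smooth_on_def]
      by (intro Ck_on_mult[OF assms(1)] Suc.IH Ck_on_SucD[OF Suc.prems])
        (use Suc.prems in auto)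
    moreover have "frechet_derivative (\<lambda>x. 1 / f x) (at x) v =
        ((-1) * frechet_derivative f (at x) v) * ((1 / f x) * (1 / f x))" if "x \<in> S" for x
      using dir_deriv_divide[of "\<lambda>_. 1" x f v, unfolded dir_deriv_const] Suc.prems that assms(2)
      by (simp add: dir_deriv_def)
    ultimately show ?thesis by (rule Ck_on_transform[OF assms(1)])
  qed
  then show ?case using dif by auto
qed

lemma smooth_on_add:
  "open S \<Longrightarrow> smooth_on f S \<Longrightarrow> smooth_on g S \<Longrightarrow> smooth_on (\<lambda>x. f x + g x) S"
  by (simp add: smooth_on_def Ck_on_add)

lemma smooth_on_mult:
  fixes f g :: "'a::real_normed_vector \<Rightarrow> real"
  shows "open S \<Longrightarrow> smooth_on f S \<Longrightarrow> smooth_on g S \<Longrightarrow> smooth_on (\<lambda>x. f x * g x) S"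
  by (simp add: smooth_on_def Ck_on_mult)

lemma smooth_on_minus:
  fixes f :: "'a::real_normed_vector \<Rightarrow> real"
  shows "open S \<Longrightarrow> smooth_on f S \<Longrightarrow> smooth_on (\<lambda>x. - f x) S"
  using smooth_on_mult[of S "\<lambda>_. -1" f] by simp

lemma smooth_on_diff:
  fixes f g :: "'a::real_normed_vector \<Rightarrow> real"
  shows "open S \<Longrightarrow> smooth_on f S \<Longrightarrow> smooth_on g S \<Longrightarrow> smooth_on (\<lambda>x. f x - g x) S"
  using smooth_on_add[OF _ _ smooth_on_minus, of S f g] by simp

lemma smooth_on_divide:
  fixes f g :: "'a::real_normed_vector \<Rightarrow> real"
  assumes "open S" "smooth_on f S" "smooth_on g S" "\<And>x. x \<in> S \<Longrightarrow> g x \<noteq> 0"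
  shows "smooth_on (\<lambda>x. f x / g x) S"
proof -
  have "smooth_on (\<lambda>x. 1 / g x) S"
    using Ck_on_inverse[of S g] assms by (simp add: smooth_on_def)
  then show ?thesis using smooth_on_mult[OF assms(1,2)] by fastforce
qed

lemma smooth_on_sum:
  assumes "open S" "\<And>i. i \<in> I \<Longrightarrow> smooth_on (f i) S"
  shows "smooth_on (\<lambda>x. \<Sum>i\<in>I. f i x) S"
  using assms(2) by (induction I rule: infinite_finite_induct) (auto intro: smooth_on_add assms(1))

lemma smooth_on_prod:
  fixes f :: "'i \<Rightarrow> 'a::real_normed_vector \<Rightarrow> real"
  assumes "open S" "\<And>i. i \<in> I \<Longrightarrow> smooth_on (f i) S"
  shows "smooth_on (\<lambda>x. \<Prod>i\<in>I. f i x) S"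
  using assms(2) by (induction I rule: infinite_finite_induct) (auto intro: smooth_on_mult assms(1))

lemma smooth_on_power:
  fixes f :: "'a::real_normed_vector \<Rightarrow> real"
  assumes "open S" "smooth_on f S"
  shows "smooth_on (\<lambda>x. f x ^ n) S"
  using assms by (induction n) (auto intro: smooth_on_mult)

section \<open>Smoothness of the inverse matrix\<close>

lemma matrix_inv:
  fixes A :: "real^'n::finite^'n"
  assumes "invertible A"
  shows "A ** matrix_inv A = mat 1" "matrix_inv A ** A = mat 1"
  using someI_ex[OF assms[unfolded invertible_def]] by (simp_all add: matrix_inv_def)

text \<open>Cramer's rule: the entry is a quotient of determinants, which are polynomials in the
  matrix entries. The numerator \<open>?A x\<close> is \<open>f x\<close> with column
  \<open>i\<close> replaced by the \<open>j\<close>-th unit vector.\<close>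

lemma smooth_on_matrix_inv:
  fixes f :: "'a::real_normed_vector \<Rightarrow> real^'n::finite^'n"
  assumes S: "open S" and f: "\<And>i j. smooth_on (\<lambda>x. f x $ i $ j) S"
    and inv: "\<And>x. x \<in> S \<Longrightarrow> invertible (f x)"
  shows "smooth_on (\<lambda>x. matrix_inv (f x) $ i $ j) S"
proof -
  let ?A = "\<lambda>x. \<chi> k l. if l = i then axis j 1 $ k else f x $ k $ l"
  have det: "smooth_on (\<lambda>x. det (A x)) S"
    if "\<And>k l. smooth_on (\<lambda>x. A x $ k $ l) S" for A :: "'a \<Rightarrow> real^'n^'n"
    unfolding det_def by (intro smooth_on_sum smooth_on_mult smooth_on_prod S smooth_on_const that)
  have "smooth_on (\<lambda>x. det (?A x) / det (f x)) S"
  proof (intro smooth_on_divide S det f)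
    show "smooth_on (\<lambda>x. ?A x $ k $ l) S" for k l
      by (cases "l = i") (auto simp: f)
    show "det (f x) \<noteq> 0" if "x \<in> S" for x
      using inv[OF that] by (simp add: invertible_det_nz)
  qed
  moreover have "matrix_inv (f x) $ i $ j = det (?A x) / det (f x)" if "x \<in> S" for x
  proof -
    have "f x *v (matrix_inv (f x) *v axis j 1) = axis j 1"
      using matrix_inv(1)[OF inv[OF that]] by (simp add: matrix_vector_mul_assoc)
    moreover have "det (f x) \<noteq> 0"
      using inv[OF that] by (simp add: invertible_det_nz)
    ultimately have "matrix_inv (f x) *v axis j 1 =
        (\<chi> k. det (\<chi> k' l. if l = k then axis j 1 $ k' else f x $ k' $ l) / det (f x))"
      using cramer by blast
    moreover have "(matrix_inv (f x) *v axis j 1) $ i = matrix_inv (f x) $ i $ j"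
      by (simp add: matrix_vector_mult_basis column_def)
    ultimately show ?thesis by simp
  qed
  ultimately show ?thesis
    using smooth_on_cong[OF S, of "\<lambda>x. matrix_inv (f x) $ i $ j" "\<lambda>x. det (?A x) / det (f x)"]
    by simp
qed

section \<open>Symmetry of second derivatives\<close>

lemma second_difference_eq:
  fixes f :: "'a::real_normed_vector \<Rightarrow> real"
  assumes t: "t > 0"
    and dif: "\<And>r s. 0 \<le> r \<Longrightarrow> r \<le> t \<Longrightarrow> 0 \<le> s \<Longrightarrow> s \<le> t \<Longrightarrow> f differentiable (at (p + r *\<^sub>R v + s *\<^sub>R w))"
    and dif2: "\<And>r s. 0 \<le> r \<Longrightarrow> r \<le> t \<Longrightarrow> 0 \<le> s \<Longrightarrow> s \<le> t \<Longrightarrow> dir_deriv v f differentiable (at (p + r *\<^sub>R v + s *\<^sub>R w))"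
  shows "\<exists>r s. 0 \<le> r \<and> r \<le> t \<and> 0 \<le> s \<and> s \<le> t \<and>
    f (p + t *\<^sub>R v + t *\<^sub>R w) - f (p + t *\<^sub>R v) - f (p + t *\<^sub>R w) + f p
      = t * t * dir_deriv w (dir_deriv v f) (p + r *\<^sub>R v + s *\<^sub>R w)"
proof -
  have 1: "((\<lambda>r. f (p + r *\<^sub>R v + s *\<^sub>R w)) has_derivative (\<lambda>h. h * dir_deriv v f (p + r *\<^sub>R v + s *\<^sub>R w)))
      (at r within A)" if "0 \<le> r" "r \<le> t" "0 \<le> s" "s \<le> t" for r s A
  proof -
    have "((\<lambda>r. f (p + r *\<^sub>R v + s *\<^sub>R w)) has_derivative (\<lambda>h. dir_deriv (h *\<^sub>R v) f (p + r *\<^sub>R v + s *\<^sub>R w)))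
        (at r within A)"
      by (rule has_derivative_compose[where f = "\<lambda>r. p + r *\<^sub>R v + s *\<^sub>R w" and g = f])
        (auto intro!: derivative_eq_intros has_derivative_dir_deriv[OF dif[OF that]])
    then show ?thesis
      using linear_frechet_derivative[OF dif[OF that]] by (simp add: dir_deriv_def linear_cmul)
  qed
  have 2: "((\<lambda>s. dir_deriv v f (p + r *\<^sub>R v + s *\<^sub>R w)) has_derivative
      (\<lambda>h. h * dir_deriv w (dir_deriv v f) (p + r *\<^sub>R v + s *\<^sub>R w)))
      (at s within A)" if "0 \<le> r" "r \<le> t" "0 \<le> s" "s \<le> t" for r s A
  proof -
    have "((\<lambda>s. dir_deriv v f (p + r *\<^sub>R v + s *\<^sub>R w)) has_derivative
        (\<lambda>h. dir_deriv (h *\<^sub>R w) (dir_deriv v f) (p + r *\<^sub>R v + s *\<^sub>R w))) (at s within A)"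
      by (rule has_derivative_compose[where f = "\<lambda>s. p + r *\<^sub>R v + s *\<^sub>R w" and g = "dir_deriv v f"])
        (auto intro!: derivative_eq_intros has_derivative_dir_deriv[OF dif2[OF that]])
    then show ?thesis
      using linear_frechet_derivative[OF dif2[OF that]] by (simp add: dir_deriv_def linear_cmul)
  qed
  \<comment> \<open>The mean value theorem is used twice: along \<open>v\<close> for this difference
    between two parallel sides, then along \<open>w\<close> for
    \<open>dir_deriv v f\<close>.\<close>
  let ?\<phi> = "\<lambda>r. f (p + r *\<^sub>R v + t *\<^sub>R w) - f (p + r *\<^sub>R v + 0 *\<^sub>R w)"
  have "\<exists>r\<in>{0<..<t}. ?\<phi> t - ?\<phi> 0 =
      (t - 0) * dir_deriv v f (p + r *\<^sub>R v + t *\<^sub>R w) - (t - 0) * dir_deriv v f (p + r *\<^sub>R v + 0 *\<^sub>R w)"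
    by (rule mvt_simple[OF t], rule has_derivative_diff; rule 1) (use t in auto)
  then obtain r where r: "0 \<le> r" "r \<le> t" "?\<phi> t - ?\<phi> 0 =
      t * (dir_deriv v f (p + r *\<^sub>R v + t *\<^sub>R w) - dir_deriv v f (p + r *\<^sub>R v + 0 *\<^sub>R w))"
    unfolding diff_0_right right_diff_distrib[symmetric] by (metis greaterThanLessThan_iff less_imp_le)
  have "\<exists>s\<in>{0<..<t}. dir_deriv v f (p + r *\<^sub>R v + t *\<^sub>R w) - dir_deriv v f (p + r *\<^sub>R v + 0 *\<^sub>R w) =
      (t - 0) * dir_deriv w (dir_deriv v f) (p + r *\<^sub>R v + s *\<^sub>R w)"
    by (rule mvt_simple[OF t], rule 2) (use t r in auto)
  then obtain s where "0 \<le> s" "s \<le> t" "dir_deriv v f (p + r *\<^sub>R v + t *\<^sub>R w) - dir_deriv v f (p + r *\<^sub>R v + 0 *\<^sub>R w) =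
      t * dir_deriv w (dir_deriv v f) (p + r *\<^sub>R v + s *\<^sub>R w)"
    unfolding diff_0_right by (metis greaterThanLessThan_iff less_imp_le)
  with r show ?thesis by (intro exI[of _ r] exI[of _ s]) (simp add: algebra_simps)
qed

text \<open>The second difference of \<open>f\<close> over a small parallelogram is symmetric in
  \<open>v\<close> and \<open>w\<close>. By \<open>second_difference_eq\<close> it is
  \<open>t * t\<close> times either mixed derivative at some point of the parallelogram, and both
  mixed derivatives are continuous at \<open>p\<close>.\<close>

lemma dir_deriv_commute:
  fixes f :: "'a::real_normed_vector \<Rightarrow> real"
  assumes S: "open S" "p \<in> S" and f: "smooth_on f S"
  shows "dir_deriv v (dir_deriv w f) p = dir_deriv w (dir_deriv v f) p"
proof -
  let ?a = "dir_deriv v (dir_deriv w f)" and ?b = "dir_deriv w (dir_deriv v f)"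
  have "\<bar>?a p - ?b p\<bar> < e" if "e > 0" for e
  proof -
    have "isCont ?a p" "isCont ?b p"
      using smooth_on_continuous[OF smooth_on_dir_deriv[OF smooth_on_dir_deriv[OF f]]] S
        continuous_on_eq_continuous_at[OF S(1)] by blast+
    then have "\<exists>d>0. \<forall>x. dist x p < d \<longrightarrow> \<bar>?a x - ?a p\<bar> < e / 2"
        "\<exists>d>0. \<forall>x. dist x p < d \<longrightarrow> \<bar>?b x - ?b p\<bar> < e / 2"
      using half_gt_zero[OF \<open>e > 0\<close>] unfolding continuous_at_eps_delta dist_real_def by blast+
    then obtain d1 d2 where d: "d1 > 0" "d2 > 0"
      "\<And>x. dist x p < d1 \<Longrightarrow> \<bar>?a x - ?a p\<bar> < e / 2" "\<And>x. dist x p < d2 \<Longrightarrow> \<bar>?b x - ?b p\<bar> < e / 2"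
      by blast
    obtain d3 where d3: "d3 > 0" "ball p d3 \<subseteq> S"
      using S open_contains_ball by blast
    define d where "d = min (min d1 d2) d3"
    have "d > 0" using d d3 by (simp add: d_def)
    \<comment> \<open>With this \<open>t\<close> the whole parallelogram stays within distance
      \<open>d\<close> of \<open>p\<close>; the summand 1 covers the case that both vectors
      vanish.\<close>
    define t where "t = d / (2 * (norm v + norm w + 1))"
    have nn: "norm v + norm w + 1 > 0" by (simp add: add_nonneg_pos)
    have t: "t > 0" using \<open>d > 0\<close> nn by (simp add: t_def)
    have td: "t * (norm v + norm w) < d"
    proof -
      have "t * (norm v + norm w) \<le> t * (norm v + norm w + 1)" using t by simp
      also have "\<dots> = d / 2" using nn by (simp add: t_def del: mult_Suc_right distrib_left_numeral)
      finally show ?thesis using \<open>d > 0\<close> by linarith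
    qed
    have near: "dist (p + r *\<^sub>R v + s *\<^sub>R w) p < d" "dist (p + r *\<^sub>R w + s *\<^sub>R v) p < d"
      if "0 \<le> r" "r \<le> t" "0 \<le> s" "s \<le> t" for r s
    proof -
      have *: "dist (p + r *\<^sub>R v + s *\<^sub>R w) p < d"
        if "0 \<le> r" "r \<le> t" "0 \<le> s" "s \<le> t" for r s
      proof -
        have "dist (p + r *\<^sub>R v + s *\<^sub>R w) p \<le> r * norm v + s * norm w"
          using norm_triangle_ineq[of "r *\<^sub>R v" "s *\<^sub>R w"] that
          by (simp add: dist_norm add.assoc)
        also have "\<dots> \<le> t * (norm v + norm w)"
          using that by (simp add: distrib_left add_mono mult_right_mono)
        finally show ?thesis using td by linarith
      qed
      show "dist (p + r *\<^sub>R v + s *\<^sub>R w) p < d" "dist (p + r *\<^sub>R w + s *\<^sub>R v) p < d"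
        using *[of r s] *[of s r] that by (simp_all add: add.assoc add.commute[of "r *\<^sub>R w"])
    qed
    have inS: "x \<in> S" if "dist x p < d" for x
      using that d3 by (auto simp: d_def dist_commute)
    have diff: "f differentiable (at x)" "dir_deriv u f differentiable (at x)"
      if "dist x p < d" for x u
      using smooth_on_differentiable[OF f] smooth_on_differentiable[OF smooth_on_dir_deriv[OF f]]
        inS[OF that] by blast+
    let ?\<Delta> = "f (p + t *\<^sub>R v + t *\<^sub>R w) - f (p + t *\<^sub>R v) - f (p + t *\<^sub>R w) + f p"
    have "\<exists>r s. 0 \<le> r \<and> r \<le> t \<and> 0 \<le> s \<and> s \<le> t \<and>
        ?\<Delta> = t * t * ?b (p + r *\<^sub>R v + s *\<^sub>R w)"
      by (intro second_difference_eq[OF t] diff near)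
    then obtain y where y: "dist y p < d" "?\<Delta> = t * t * ?b y"
      using near(1) by blast
    have "\<exists>r s. 0 \<le> r \<and> r \<le> t \<and> 0 \<le> s \<and> s \<le> t \<and>
        f (p + t *\<^sub>R w + t *\<^sub>R v) - f (p + t *\<^sub>R w) - f (p + t *\<^sub>R v) + f p
          = t * t * ?a (p + r *\<^sub>R w + s *\<^sub>R v)"
      by (intro second_difference_eq[OF t] diff near)
    then obtain x where x: "dist x p < d"
        "f (p + t *\<^sub>R w + t *\<^sub>R v) - f (p + t *\<^sub>R w) - f (p + t *\<^sub>R v) + f p = t * t * ?a x"
      using near(2) by blast
    have "p + t *\<^sub>R w + t *\<^sub>R v = p + t *\<^sub>R v + t *\<^sub>R w" by simp
    from x(2)[unfolded this] y(2) have "t * t * ?a x = t * t * ?b y" by linarith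
    then have "?a x = ?b y" using t by simp
    moreover have "\<bar>?a x - ?a p\<bar> < e / 2" "\<bar>?b y - ?b p\<bar> < e / 2"
      using d x(1) y(1) by (simp_all add: d_def)
    ultimately show ?thesis by linarith
  qed
  \<comment> \<open>If the two values differed, their distance would be an admissible
    \<open>e\<close> and hence smaller than itself.\<close>
  from this[of "\<bar>?a p - ?b p\<bar>"] show ?thesis by (cases "?a p = ?b p") auto
qed

lemma sum_axis:
  fixes f :: "'n::finite \<Rightarrow> real"
  shows "(\<Sum>j\<in>UNIV. axis k 1 $ j * f j) = f k" "(\<Sum>j\<in>UNIV. f j * axis k 1 $ j) = f k"
    "(\<Sum>j\<in>UNIV. f j * axis j 1 $ k) = f k"
  by (simp_all add: axis_def if_distrib if_distribR cong: if_cong)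

lemma dir_deriv_expand:
  fixes f :: "(real^'n::finite) \<times> (real^'n) \<Rightarrow> real"
  assumes "f differentiable (at p)"
  shows "dir_deriv v f p = (\<Sum>i\<in>UNIV. fst v $ i * dx i f p) + (\<Sum>i\<in>UNIV. snd v $ i * dy i f p)"
proof -
  interpret linear "frechet_derivative f (at p)"
    using assms by (rule linear_frechet_derivative)
  have "v = (\<Sum>i\<in>UNIV. fst v $ i *\<^sub>R (axis i 1, 0)) + (\<Sum>i\<in>UNIV. snd v $ i *\<^sub>R (0, axis i 1))"
    by (simp add: prod_eq_iff fst_sum snd_sum vec_eq_iff sum_axis)
  then have "dir_deriv v f p = frechet_derivative f (at p) ((\<Sum>i\<in>UNIV. fst v $ i *\<^sub>R (axis i 1, 0))
      + (\<Sum>i\<in>UNIV. snd v $ i *\<^sub>R (0, axis i 1)))"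
    unfolding dir_deriv_def by simp
  also have "\<dots> = (\<Sum>i\<in>UNIV. fst v $ i * dx i f p) + (\<Sum>i\<in>UNIV. snd v $ i * dy i f p)"
    unfolding add sum scale dx_def dy_def by simp
  finally show ?thesis .
qed

lemma dx_eq: "dx i f = dir_deriv (axis i 1, 0) f"
  by (simp add: dx_def dir_deriv_def[abs_def])

lemma dy_eq: "dy i f = dir_deriv (0, axis i 1) f"
  by (simp add: dy_def dir_deriv_def[abs_def])

text \<open>Polarization: the values of the quadratic form at two unit vectors and at their sum
  determine the mixed entry.\<close>

lemma symmetric_form_eq_0:
  fixes A :: "'n::finite \<Rightarrow> 'n \<Rightarrow> real"
  assumes sym: "\<And>i j. A i j = A j i"
    and zero: "\<And>u :: real^'n. (\<Sum>i\<in>UNIV. \<Sum>j\<in>UNIV. A i j * u $ i * u $ j) = 0"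
  shows "A i j = 0"
proof -
  have ax: "(\<Sum>a\<in>UNIV. \<Sum>b\<in>UNIV. A a b * axis i 1 $ a * axis j 1 $ b) = A i j" for i j
    by (simp add: sum_axis)
  have *: "A i i = 0" for i
    using zero[of "axis i 1"] by (simp add: ax)
  have "A i i + A i j + A j i + A j j = 0"
    using zero[of "axis i 1 + axis j 1"]
    by (simp add: distrib_left distrib_right sum.distrib ax)
  then show ?thesis using * sym[of i j] by simp
qed

section \<open>Finsler geometry over a single chart\<close>

text \<open>The coordinate form of a Finsler metric over the image \<open>W\<close> of one chart.
  All tensors involved are given by coordinate formulas, so the geometric argument can be carried
  out chart by chart.\<close>

locale finsler_chart =
  fixes F :: "'n::finite fn" and W :: "(real^'n) set"
  assumes open_W: "open W"
    and smooth_F: "smooth_on F (W \<times> (UNIV - {0}))"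
    and homogeneous_F: "x \<in> W \<Longrightarrow> y \<noteq> 0 \<Longrightarrow> t > 0 \<Longrightarrow> F (x, t *\<^sub>R y) = t * F (x, y)"
    and fund_pos: "p \<in> W \<times> (UNIV - {0}) \<Longrightarrow> u \<noteq> 0 \<Longrightarrow> fund_form F p u u > 0"
begin

definition U :: "((real^'n) \<times> (real^'n)) set" where "U = W \<times> (UNIV - {0})"

abbreviation G where "G \<equiv> spray F"
abbreviation g where "g \<equiv> fund F"
abbreviation g' where "g' \<equiv> fund_inv F"
abbreviation C where "C \<equiv> cartan F"
abbreviation N where "N i k \<equiv> dy k (spray F i)"
abbreviation B where "B \<equiv> berwald F"

text \<open>The energy. With \<open>E\<close> in place of \<open>F^2\<close> the vertical Hessian is
  \<open>g\<close> itself, and \<open>dy i E\<close> is the covector obtained from \<open>y\<close>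
  by lowering its index.\<close>

definition E :: "'n fn" where "E = (\<lambda>p. (F p)\<^sup>2 / 2)"

lemma open_U: "open U"
  unfolding U_def by (intro open_Times open_W) auto

lemmas smooth_simps [simp] = smooth_on_add[OF open_U] smooth_on_mult[OF open_U]
  smooth_on_minus[OF open_U] smooth_on_diff[OF open_U] smooth_on_divide[OF open_U]
  smooth_on_sum[OF open_U] smooth_on_power[OF open_U]

lemma smooth_dir_deriv [simp]: "smooth_on f U \<Longrightarrow> smooth_on (dir_deriv v f) U"
  by (rule smooth_on_dir_deriv)

lemma smooth_dx [simp]: "smooth_on f U \<Longrightarrow> smooth_on (dx i f) U"
  by (simp add: dx_eq)

lemma smooth_dy [simp]: "smooth_on f U \<Longrightarrow> smooth_on (dy i f) U"
  by (simp add: dy_eq)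

lemma differentiable_smooth [simp]: "smooth_on f U \<Longrightarrow> p \<in> U \<Longrightarrow> f differentiable (at p)"
  by (rule smooth_on_differentiable)

lemma smooth_eq_on: "smooth_on f U" if "\<And>p. p \<in> U \<Longrightarrow> f p = h p" "smooth_on h U"
  using smooth_on_cong[OF open_U, of f h] that by simp

lemma dir_deriv_eq_on:
  "p \<in> U \<Longrightarrow> (\<And>q. q \<in> U \<Longrightarrow> f q = h q) \<Longrightarrow> h differentiable (at p) \<Longrightarrow>
    dir_deriv v f p = dir_deriv v h p"
  by (rule dir_deriv_cong[OF open_U])

lemma commute: "smooth_on f U \<Longrightarrow> p \<in> U \<Longrightarrow>
    dir_deriv v (dir_deriv w f) p = dir_deriv w (dir_deriv v f) p" for f :: "'n fn"
  by (rule dir_deriv_commute[OF open_U])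

lemma smooth_coordinate [simp]: "smooth_on (\<lambda>q. snd q $ i) U"
  by (intro smooth_on_bounded_linear bounded_linear_compose[OF bounded_linear_vec_nth bounded_linear_snd])

lemma dir_deriv_coordinate [simp]: "dir_deriv v (\<lambda>q. snd q $ i) p = snd v $ i"
  by (intro dir_deriv_eq bounded_linear_imp_has_derivative
      bounded_linear_compose[OF bounded_linear_vec_nth bounded_linear_snd])

lemma smooth_F' [simp]: "smooth_on F U"
  using smooth_F by (simp add: U_def)

lemma smooth_E [simp]: "smooth_on E U"
  by (simp add: E_def)

lemma fund_eq: "p \<in> U \<Longrightarrow> g i j p = dy j (dy i E) p"
proof -
  have 1: "dy i E q = 1 / 2 * dy i (\<lambda>q. (F q)\<^sup>2) q" if "q \<in> U" for i q
    using that dir_deriv_mult[of "\<lambda>_. 1 / 2" q "\<lambda>q. (F q)\<^sup>2"] by (simp add: dy_eq E_def)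
  assume p: "p \<in> U"
  have "dy j (dy i E) p = dy j (\<lambda>q. 1 / 2 * dy i (\<lambda>q. (F q)\<^sup>2) q) p"
    unfolding dy_eq[of j] by (rule dir_deriv_eq_on[OF p 1]) (simp_all add: p)
  also have "\<dots> = g i j p"
    using p dir_deriv_mult[of "\<lambda>_. 1 / 2" p "dy i (\<lambda>q. (F q)\<^sup>2)"] by (simp add: dy_eq[of j] fund_def)
  finally show ?thesis by simp
qed

lemma smooth_fund [simp]: "smooth_on (g i j) U"
  by (simp add: fund_def)

lemma fund_sym: "p \<in> U \<Longrightarrow> g i j p = g j i p"
  by (simp add: fund_eq dy_eq commute[of E])

lemma dir_deriv_fund: "p \<in> U \<Longrightarrow> dir_deriv v (g i j) p = dir_deriv v (dy j (dy i E)) p"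
  by (rule dir_deriv_eq_on) (simp_all add: fund_eq)

lemma smooth_cartan [simp]: "smooth_on (C i j k) U"
  by (simp add: cartan_def)

section \<open>Homogeneity and Euler relations\<close>

lemma euler_E:
  assumes p: "p \<in> U"
  shows "(\<Sum>i\<in>UNIV. snd p $ i * dy i E p) = 2 * E p"
proof -
  obtain x y where xy: "p = (x, y)" "x \<in> W" "y \<noteq> 0" using p by (auto simp: U_def)
  have d: "E differentiable (at p)" using p by simp
  \<comment> \<open>The derivative of \<open>E\<close> along the ray through \<open>y\<close> at
    \<open>t = 1\<close> is computed twice: here by the chain rule, then from homogeneity of degree
    2.\<close>
  have 1: "((\<lambda>t. E (x, t *\<^sub>R y)) has_derivative (\<lambda>h. dir_deriv (0, h *\<^sub>R y) E p)) (at 1)"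
    by (rule has_derivative_compose[where f = "\<lambda>t. (x, t *\<^sub>R y)" and g = E])
      (use has_derivative_dir_deriv[OF d] in \<open>auto intro!: derivative_eq_intros simp: xy(1)\<close>)
  have 2: "((\<lambda>t. E (x, t *\<^sub>R y)) has_derivative (\<lambda>h. h * (2 * E p))) (at 1)"
  proof (rule has_derivative_transform_within_open[of "\<lambda>t. t\<^sup>2 * E p" _ 1 UNIV "{0<..}"])
    show "((\<lambda>t. t\<^sup>2 * E p) has_derivative (\<lambda>h. h * (2 * E p))) (at 1)"
      by (auto intro!: derivative_eq_intros simp: mult_ac)
    show "t\<^sup>2 * E p = E (x, t *\<^sub>R y)" if "t \<in> {0<..}" for t
      using that xy homogeneous_F[of x y t] by (simp add: E_def power_mult_distrib)
  qed auto
  have "dir_deriv (0, y) E p = 2 * E p"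
    using fun_cong[OF has_derivative_unique[OF 1 2], of 1] by simp
  then show ?thesis
    using dir_deriv_expand[OF d, of "(0, y)"] by (simp add: xy(1))
qed

text \<open>Euler's relation of degree \<open>r\<close> is differentiated in a direction
  \<open>v\<close>. A vertical \<open>v\<close> also hits the factor \<open>y\<close> and lowers the
  degree by one; a direction along the base leaves the degree unchanged.\<close>

lemma euler_deriv:
  assumes f: "smooth_on f U" and p: "p \<in> U"
    and e: "\<And>q. q \<in> U \<Longrightarrow> (\<Sum>i\<in>UNIV. snd q $ i * dy i f q) = r * f q"
  shows "(\<Sum>i\<in>UNIV. snd p $ i * dy i (dy j f) p) = (r - 1) * dy j f p"
    and "(\<Sum>i\<in>UNIV. snd p $ i * dy i (dx j f) p) = r * dx j f p"
proof -
  have *: "(\<Sum>i\<in>UNIV. snd p $ i * dy i (dir_deriv v f) p) + (\<Sum>i\<in>UNIV. snd v $ i * dy i f p)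
      = r * dir_deriv v f p" for v
  proof -
    have "dir_deriv v (\<lambda>q. \<Sum>i\<in>UNIV. snd q $ i * dy i f q) p = dir_deriv v (\<lambda>q. r * f q) p"
      by (rule dir_deriv_eq_on[OF p e]) (simp_all add: f p)
    then show ?thesis
      using f p by (simp add: dir_deriv_sum dir_deriv_mult dy_eq commute[of f p v] sum.distrib)
  qed
  show "(\<Sum>i\<in>UNIV. snd p $ i * dy i (dy j f) p) = (r - 1) * dy j f p"
    using *[of "(0, axis j 1)"] by (simp add: dy_eq[of j] sum_axis algebra_simps)
  show "(\<Sum>i\<in>UNIV. snd p $ i * dy i (dx j f) p) = r * dx j f p"
    using *[of "(axis j 1, 0)"] by (simp add: dx_eq)
qed

lemma euler_E_dy: "p \<in> U \<Longrightarrow> (\<Sum>i\<in>UNIV. snd p $ i * dy i (dy j E) p) = dy j E p"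
  using euler_deriv(1)[OF smooth_E _ euler_E, of p j] by simp

lemma euler_E_dx: "p \<in> U \<Longrightarrow> (\<Sum>i\<in>UNIV. snd p $ i * dy i (dx j E) p) = 2 * dx j E p"
  using euler_deriv(2)[OF smooth_E _ euler_E, of p j] by simp

lemma fund_y: "p \<in> U \<Longrightarrow> (\<Sum>j\<in>UNIV. g i j p * snd p $ j) = dy i E p"
  using euler_E_dy[of p i] by (simp add: fund_eq mult.commute)

lemma y_low_eq: "p \<in> U \<Longrightarrow> y_low F i p = dy i E p"
  by (simp add: y_low_def fund_y)

lemma euler_fund: "p \<in> U \<Longrightarrow> (\<Sum>k\<in>UNIV. snd p $ k * dy k (g i j) p) = 0"
  using euler_deriv(1)[of "dy i E" p 1 j] euler_E_dy by (simp add: dy_eq dir_deriv_fund)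

lemma cartan_y: "p \<in> U \<Longrightarrow> (\<Sum>k\<in>UNIV. C i j k p * snd p $ k) = 0"
  using euler_fund[of p i j] by (simp add: cartan_def mult.commute flip: sum_divide_distrib)

text \<open>Two Euler relations identify the squared length of \<open>y\<close> in the fundamental
  form with \<open>2 * E p\<close>.\<close>

lemma E_pos:
  assumes p: "p \<in> U"
  shows "E p > 0"
proof -
  have "fund_form F p (snd p) (snd p) = (\<Sum>i\<in>UNIV. snd p $ i * (\<Sum>j\<in>UNIV. g i j p * snd p $ j))"
    by (simp add: fund_form_def sum_distrib_left mult_ac)
  also have "\<dots> = 2 * E p" using p by (simp add: fund_y euler_E)
  finally have "fund_form F p (snd p) (snd p) = 2 * E p" .
  moreover have "snd p \<noteq> 0" "p \<in> W \<times> (UNIV - {0})" using p by (auto simp: U_def)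
  ultimately show ?thesis using fund_pos[of p "snd p"] by simp
qed

lemma invertible_fund:
  assumes p: "p \<in> U"
  shows "invertible ((\<chi> k l. g k l p) :: real^'n^'n)"
proof -
  have "u = 0" if "((\<chi> k l. g k l p) :: real^'n^'n) *v u = 0" for u
  proof (rule ccontr)
    assume "u \<noteq> 0"
    have "fund_form F p u u = (\<Sum>i\<in>UNIV. u $ i * (((\<chi> k l. g k l p) :: real^'n^'n) *v u) $ i)"
      by (simp add: fund_form_def matrix_vector_mult_def sum_distrib_left mult_ac)
    then show False using fund_pos[of p u] \<open>u \<noteq> 0\<close> p that by (simp add: U_def)
  qed
  then show ?thesis
    by (metis invertible_left_inverse matrix_left_invertible_ker)
qed

lemma smooth_fund_inv [simp]: "smooth_on (g' i j) U"
  unfolding fund_inv_def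
  by (rule smooth_on_matrix_inv[OF open_U _ invertible_fund]) simp_all

lemma fund_inv:
  assumes p: "p \<in> U"
  shows "(\<Sum>j\<in>UNIV. g i j p * g' j k p) = (if i = k then 1 else 0)"
    "(\<Sum>j\<in>UNIV. g' i j p * g j k p) = (if i = k then 1 else 0)"
  using arg_cong[OF matrix_inv(1)[OF invertible_fund[OF p]], of "\<lambda>A. A $ i $ k"]
    arg_cong[OF matrix_inv(2)[OF invertible_fund[OF p]], of "\<lambda>A. A $ i $ k"]
  by (simp_all add: matrix_matrix_mult_def fund_inv_def mat_def)

text \<open>Nondegeneracy of the metric: identities between contravariant components can be checked
  after lowering the index, which avoids differentiating the inverse metric.\<close>

lemma fund_inject:
  assumes p: "p \<in> U" and e: "\<And>l. (\<Sum>i\<in>UNIV. g l i p * u i) = (\<Sum>i\<in>UNIV. g l i p * v i)"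
  shows "u k = v k"
proof -
  have *: "(\<Sum>l\<in>UNIV. g' k l p * (\<Sum>i\<in>UNIV. g l i p * u i)) = u k" for u
  proof -
    have "(\<Sum>l\<in>UNIV. g' k l p * (\<Sum>i\<in>UNIV. g l i p * u i)) =
        (\<Sum>i\<in>UNIV. (\<Sum>l\<in>UNIV. g' k l p * g l i p) * u i)"
      unfolding sum_distrib_left sum_distrib_right by (subst sum.swap) (simp add: mult.assoc)
    also have "\<dots> = u k" by (simp add: fund_inv[OF p] if_distrib if_distribR cong: if_cong)
    finally show ?thesis .
  qed
  show ?thesis using *[of u] *[of v] e by simp
qed

lemma smooth_spray [simp]: "smooth_on (G i) U"
  by (simp add: spray_def)

lemma fund_spray:
  assumes p: "p \<in> U"
  shows "2 * (\<Sum>i\<in>UNIV. g l i p * G i p) = (\<Sum>k\<in>UNIV. snd p $ k * dx k (dy l E) p) - dx l E p"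
proof -
  let ?Q = "\<lambda>q. (F q)\<^sup>2"
  let ?r = "\<lambda>l. (\<Sum>k\<in>UNIV. dx k (dy l ?Q) p * snd p $ k) - dx l ?Q p"
  have 1: "dir_deriv v ?Q q = 2 * dir_deriv v E q" if "q \<in> U" for q v
    using that dir_deriv_mult[of "\<lambda>_. 2" q E] by (simp add: E_def)
  have 2: "dx k (dy l ?Q) p = 2 * dx k (dy l E) p" for k l
  proof -
    have "dx k (dy l ?Q) p = dx k (\<lambda>q. 2 * dy l E q) p"
      unfolding dx_eq dy_eq by (rule dir_deriv_eq_on[OF p 1]) (simp_all add: p)
    then show ?thesis using p by (simp add: dx_eq dir_deriv_mult)
  qed
  have "(\<Sum>i\<in>UNIV. g l i p * G i p) = (\<Sum>i\<in>UNIV. \<Sum>m\<in>UNIV. g l i p * g' i m p * (1/4 * ?r m))"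
    by (simp add: spray_def sum_distrib_left sum_divide_distrib mult.assoc)
  also have "\<dots> = (\<Sum>m\<in>UNIV. (\<Sum>i\<in>UNIV. g l i p * g' i m p) * (1/4 * ?r m))"
    by (subst sum.swap) (simp only: sum_distrib_right)
  also have "\<dots> = 1/4 * ?r l"
    by (simp add: fund_inv[OF p] if_distribR if_distrib cong: if_cong)
  also have "\<dots> = 1/2 * ((\<Sum>k\<in>UNIV. snd p $ k * dx k (dy l E) p) - dx l E p)"
    unfolding 2 dx_eq[of l] 1[OF p] by (simp add: sum_distrib_left mult_ac)
  finally show ?thesis by simp
qed

text \<open>The spray and the horizontal lifts of the coordinate fields, as vectors at \<open>p\<close>.\<close>

definition SV :: "(real^'n) \<times> (real^'n) \<Rightarrow> (real^'n) \<times> (real^'n)" where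
  "SV p = (snd p, \<chi> i. - 2 * G i p)"

definition HV :: "'n \<Rightarrow> (real^'n) \<times> (real^'n) \<Rightarrow> (real^'n) \<times> (real^'n)" where
  "HV k p = (axis k 1, \<chi> i. - N i k p)"

definition S :: "'n fn \<Rightarrow> 'n fn" where "S f p = dir_deriv (SV p) f p"

lemma S_expand: "f differentiable (at p) \<Longrightarrow>
    S f p = (\<Sum>i\<in>UNIV. snd p $ i * dx i f p) - 2 * (\<Sum>i\<in>UNIV. G i p * dy i f p)"
  by (simp add: S_def SV_def dir_deriv_expand[of f p] sum_negf sum_distrib_left mult.assoc)

lemma delta_eq: "f differentiable (at p) \<Longrightarrow> delta F k f p = dir_deriv (HV k p) f p"
  by (simp add: delta_def HV_def dir_deriv_expand[of f p] sum_axis sum_negf)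

lemma smooth_S [simp]: "smooth_on f U \<Longrightarrow> smooth_on (S f) U"
  by (rule smooth_eq_on[OF S_expand]) simp_all

lemma smooth_delta [simp]: "smooth_on f U \<Longrightarrow> smooth_on (delta F k f) U"
  by (simp add: delta_def)

text \<open>The Euler-Lagrange equation of the energy along the spray: by \<open>fund_spray\<close>
  the second-order terms of the expansion cancel.\<close>

lemma S_dy_E:
  assumes p: "p \<in> U"
  shows "S (dy l E) p = dx l E p"
proof -
  have "S (dy l E) p = (\<Sum>k\<in>UNIV. snd p $ k * dx k (dy l E) p) - 2 * (\<Sum>i\<in>UNIV. g l i p * G i p)"
    using p by (simp add: S_expand fund_eq mult.commute)
  then show ?thesis using fund_spray[OF p, of l] by simp
qed

text \<open>The vertical derivative of \<open>fund_spray\<close> is contracted with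
  \<open>y\<close>. On the left \<open>g\<close> has degree 0, so only the spray is affected. On the
  right both terms have degree 2: \<open>dx k (dy l E)\<close> has degree 1 and is multiplied by
  \<open>y\<close>, while \<open>dx l E\<close> has degree 2 itself.\<close>

lemma euler_spray:
  assumes p: "p \<in> U"
  shows "(\<Sum>i\<in>UNIV. snd p $ i * dy i (G k) p) = 2 * G k p"
proof (rule fund_inject[OF p])
  fix l
  let ?L = "\<lambda>q. 2 * (\<Sum>i\<in>UNIV. g l i q * G i q)"
  let ?R = "\<lambda>q. (\<Sum>k\<in>UNIV. snd q $ k * dx k (dy l E) q) - dx l E q"
  have "dy j ?L p = dy j ?R p" for j
    unfolding dy_eq by (rule dir_deriv_eq_on[OF p]) (use fund_spray p in \<open>simp_all add: dy_eq\<close>)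
  then have j: "2 * (\<Sum>i\<in>UNIV. g l i p * dy j (G i) p + dy j (g l i) p * G i p) =
      (\<Sum>k\<in>UNIV. snd p $ k * dy j (dx k (dy l E)) p) + dx j (dy l E) p - dy j (dx l E) p" for j
    using p by (simp add: dy_eq dx_eq dir_deriv_mult dir_deriv_sum dir_deriv_diff sum.distrib sum_axis)
  have "(\<Sum>j\<in>UNIV. snd p $ j * (2 * (\<Sum>i\<in>UNIV. g l i p * dy j (G i) p + dy j (g l i) p * G i p))) =
      2 * (\<Sum>i\<in>UNIV. g l i p * (\<Sum>j\<in>UNIV. snd p $ j * dy j (G i) p) + (\<Sum>j\<in>UNIV. snd p $ j * dy j (g l i) p) * G i p)"
    unfolding sum_distrib_left sum_distrib_right distrib_left sum.distrib
    by (subst (1 2) sum.swap) (simp add: mult_ac)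
  then have 1: "(\<Sum>j\<in>UNIV. snd p $ j * (2 * (\<Sum>i\<in>UNIV. g l i p * dy j (G i) p + dy j (g l i) p * G i p))) =
      2 * (\<Sum>i\<in>UNIV. g l i p * (\<Sum>j\<in>UNIV. snd p $ j * dy j (G i) p))"
    by (simp add: euler_fund[OF p])
  have "(\<Sum>j\<in>UNIV. snd p $ j * ((\<Sum>k\<in>UNIV. snd p $ k * dy j (dx k (dy l E)) p) + dx j (dy l E) p - dy j (dx l E) p)) =
      (\<Sum>k\<in>UNIV. snd p $ k * (\<Sum>j\<in>UNIV. snd p $ j * dy j (dx k (dy l E)) p))
      + (\<Sum>j\<in>UNIV. snd p $ j * dx j (dy l E) p) - (\<Sum>j\<in>UNIV. snd p $ j * dy j (dx l E) p)"
    unfolding right_diff_distrib distrib_left sum.distrib sum_subtractf sum_distrib_left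
    by (subst (1) sum.swap) (simp add: mult_ac)
  also have "\<dots> = 2 * ((\<Sum>j\<in>UNIV. snd p $ j * dx j (dy l E) p) - dx l E p)"
    using euler_deriv(2)[of "dy l E" p 1] euler_E_dy by (simp add: euler_E_dx[OF p] p)
  also have "\<dots> = 2 * (2 * (\<Sum>i\<in>UNIV. g l i p * G i p))"
    by (simp add: fund_spray[OF p])
  finally have 2: "(\<Sum>j\<in>UNIV. snd p $ j * ((\<Sum>k\<in>UNIV. snd p $ k * dy j (dx k (dy l E)) p) + dx j (dy l E) p - dy j (dx l E) p)) =
      2 * (2 * (\<Sum>i\<in>UNIV. g l i p * G i p))" .
  have "(\<Sum>i\<in>UNIV. g l i p * (2 * G i p)) = 2 * (\<Sum>i\<in>UNIV. g l i p * G i p)"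
    by (simp add: sum_distrib_left mult_ac)
  with 1[unfolded j 2]
  show "(\<Sum>i\<in>UNIV. g l i p * (\<Sum>j\<in>UNIV. snd p $ j * dy j (G i) p)) = (\<Sum>i\<in>UNIV. g l i p * (2 * G i p))"
    by linarith
qed

lemma N_y: "p \<in> U \<Longrightarrow> (\<Sum>k\<in>UNIV. N i k p * snd p $ k) = 2 * G i p"
  using euler_spray[of p i] by (simp add: mult.commute)

lemma B_y: "p \<in> U \<Longrightarrow> (\<Sum>k\<in>UNIV. B i j k p * snd p $ k) = N i j p"
  using euler_deriv(1)[of "G i" p 2 j] euler_spray by (simp add: berwald_def mult.commute)

lemma B_sym: "p \<in> U \<Longrightarrow> B i j k p = B i k j p"
  by (simp add: berwald_def dy_eq commute[of "G i"])

lemma smooth_B [simp]: "smooth_on (B i j k) U"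
  by (simp add: berwald_def)

section \<open>The derivative along the spray\<close>

lemmas dir_deriv_rules = dir_deriv_add dir_deriv_diff dir_deriv_mult dir_deriv_sum

lemma S_rules:
  assumes "f differentiable (at p)" "h differentiable (at p)"
  shows "S (\<lambda>q. f q + h q) p = S f p + S h p"
    "S (\<lambda>q. f q - h q) p = S f p - S h p"
    "S (\<lambda>q. f q * h q) p = f p * S h p + S f p * h p"
  using assms by (simp_all add: S_def dir_deriv_rules)

lemma S_sum: "(\<And>i. i \<in> I \<Longrightarrow> f i differentiable (at p)) \<Longrightarrow>
    S (\<lambda>q. \<Sum>i\<in>I. f i q) p = (\<Sum>i\<in>I. S (f i) p)"
  by (simp add: S_def dir_deriv_sum)

lemma S_const [simp]: "S (\<lambda>q. c) p = 0"
  by (simp add: S_def)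

lemma S_coordinate [simp]: "S (\<lambda>q. snd q $ i) p = - 2 * G i p"
  by (simp add: S_def SV_def)

lemma S_eq_on: "p \<in> U \<Longrightarrow> (\<And>q. q \<in> U \<Longrightarrow> f q = h q) \<Longrightarrow> h differentiable (at p) \<Longrightarrow> S f p = S h p"
  unfolding S_def by (rule dir_deriv_eq_on)

text \<open>The spray vector is horizontal: it is the combination of the horizontal lifts with
  coefficients \<open>y\<close>, because \<open>N_y\<close> gives the vertical part.\<close>

lemma S_delta:
  assumes p: "p \<in> U" and f: "f differentiable (at p)"
  shows "(\<Sum>m\<in>UNIV. delta F m f p * snd p $ m) = S f p"
proof -
  have "(\<Sum>m\<in>UNIV. (\<Sum>s\<in>UNIV. N s m p * dy s f p) * snd p $ m) =
      (\<Sum>s\<in>UNIV. (\<Sum>m\<in>UNIV. N s m p * snd p $ m) * dy s f p)"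
    unfolding sum_distrib_right by (subst sum.swap) (simp add: mult_ac)
  also have "\<dots> = 2 * (\<Sum>s\<in>UNIV. G s p * dy s f p)"
    by (simp add: N_y[OF p] sum_distrib_left mult.assoc)
  finally have "(\<Sum>m\<in>UNIV. (\<Sum>s\<in>UNIV. N s m p * dy s f p) * snd p $ m) =
      2 * (\<Sum>s\<in>UNIV. G s p * dy s f p)" .
  then show ?thesis
    by (simp only: delta_def left_diff_distrib sum_subtractf S_expand[OF f]) (simp add: mult.commute)
qed

text \<open>The contraction of the horizontal derivative of a covariant 3-tensor with \<open>y\<close>: by
  homogeneity \<open>y\<^sup>m G\<^sup>s\<^sub>i\<^sub>m = N\<^sup>s\<^sub>i\<close>.\<close>

definition D3 :: "('n \<Rightarrow> 'n \<Rightarrow> 'n \<Rightarrow> 'n fn) \<Rightarrow> 'n \<Rightarrow> 'n \<Rightarrow> 'n \<Rightarrow> 'n fn" where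
  "D3 T i j k p = S (T i j k) p - (\<Sum>s\<in>UNIV. N s i p * T s j k p)
     - (\<Sum>s\<in>UNIV. N s j p * T i s k p) - (\<Sum>s\<in>UNIV. N s k p * T i j s p)"

lemma landsberg_eq:
  assumes p: "p \<in> U"
  shows "landsberg F i j k p = D3 C i j k p"
proof -
  have B: "(\<Sum>m\<in>UNIV. (\<Sum>s\<in>UNIV. T s * B s l m p) * snd p $ m) = (\<Sum>s\<in>UNIV. N s l p * T s)"
    for T l
  proof -
    have "(\<Sum>m\<in>UNIV. (\<Sum>s\<in>UNIV. T s * B s l m p) * snd p $ m) =
        (\<Sum>s\<in>UNIV. T s * (\<Sum>m\<in>UNIV. B s l m p * snd p $ m))"
      unfolding sum_distrib_right sum_distrib_left by (subst sum.swap) (simp add: mult_ac)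
    then show ?thesis by (simp only: B_y[OF p] mult.commute[of "T _"])
  qed
  have "landsberg F i j k p = (\<Sum>m\<in>UNIV. delta F m (C i j k) p * snd p $ m)
     - (\<Sum>m\<in>UNIV. (\<Sum>s\<in>UNIV. C s j k p * B s i m p) * snd p $ m)
     - (\<Sum>m\<in>UNIV. (\<Sum>s\<in>UNIV. C i s k p * B s j m p) * snd p $ m)
     - (\<Sum>m\<in>UNIV. (\<Sum>s\<in>UNIV. C i j s p * B s k m p) * snd p $ m)"
    by (simp only: landsberg_def hderiv_cov3_def left_diff_distrib sum_subtractf)
  then show ?thesis
    by (simp only: B D3_def S_delta[OF p differentiable_smooth[OF smooth_cartan p]])
qed

lemma smooth_D3 [simp]: "(\<And>i j k. smooth_on (T i j k) U) \<Longrightarrow> smooth_on (D3 T i j k) U"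
  by (simp add: D3_def[abs_def])

section \<open>Energy and metric along the spray\<close>

lemma S_E:
  assumes p: "p \<in> U"
  shows "S E p = 0"
proof -
  have "S (\<lambda>q. \<Sum>i\<in>UNIV. snd q $ i * dy i E q) p = S (\<lambda>q. 2 * E q) p"
    by (rule S_eq_on[OF p euler_E]) (simp_all add: p)
  \<comment> \<open>By \<open>S_dy_E\<close> the left side is the coordinate expansion of
    \<open>S E p\<close>, so \<open>S E p\<close> equals its own double.\<close>
  then have "(\<Sum>i\<in>UNIV. snd p $ i * dx i E p) - 2 * (\<Sum>i\<in>UNIV. G i p * dy i E p) = 2 * S E p"
    using p by (simp add: S_sum S_rules S_dy_E sum.distrib sum_subtractf sum_distrib_left sum_negf mult.assoc)
  then show ?thesis using p by (simp add: S_expand)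
qed

lemma dir_deriv_S:
  assumes p: "p \<in> U" and f: "smooth_on f U"
  shows "dir_deriv v (S f) p = S (dir_deriv v f) p + (\<Sum>i\<in>UNIV. snd v $ i * dx i f p)
    - 2 * (\<Sum>i\<in>UNIV. dir_deriv v (G i) p * dy i f p)"
proof -
  have "dir_deriv v (S f) p = dir_deriv v (\<lambda>q. (\<Sum>i\<in>UNIV. snd q $ i * dx i f q) - 2 * (\<Sum>i\<in>UNIV. G i q * dy i f q)) p"
    by (rule dir_deriv_eq_on[OF p S_expand]) (simp_all add: f p)
  also have "\<dots> = (\<Sum>i\<in>UNIV. snd p $ i * dx i (dir_deriv v f) p) + (\<Sum>i\<in>UNIV. snd v $ i * dx i f p)
    - 2 * ((\<Sum>i\<in>UNIV. G i p * dy i (dir_deriv v f) p) + (\<Sum>i\<in>UNIV. dir_deriv v (G i) p * dy i f p))"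
    using f p by (simp add: dir_deriv_rules sum.distrib dx_eq dy_eq commute[of f p v])
  finally show ?thesis using p f by (simp add: S_expand)
qed

text \<open>The commutator of a vertical coordinate field with the spray, the device that turns
  facts about \<open>S\<close> into facts about \<open>delta\<close>. It contains \<open>N\<close>
  twice: one copy completes \<open>dx\<close> to \<open>delta\<close>, the other remains as a
  connection term.\<close>

lemma dy_S:
  assumes p: "p \<in> U" and f: "smooth_on f U"
  shows "dy k (S f) p = S (dy k f) p + delta F k f p - (\<Sum>s\<in>UNIV. N s k p * dy s f p)"
  using dir_deriv_S[OF p f, of "(0, axis k 1)"]
  by (simp add: delta_def sum_axis flip: dy_eq)

text \<open>By \<open>dy_S\<close> and \<open>S_dy_E\<close>, the vertical derivative of
  \<open>S_E\<close> is twice this identity.\<close>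

lemma delta_E:
  assumes p: "p \<in> U"
  shows "delta F k E p = 0"
proof -
  have "dy k (S E) p = dy k (\<lambda>q. 0) p"
    unfolding dy_eq by (rule dir_deriv_eq_on[OF p S_E]) auto
  then have "S (dy k E) p + delta F k E p - (\<Sum>s\<in>UNIV. N s k p * dy s E p) = 0"
    using p by (simp add: dy_S dy_eq[of k "\<lambda>q. 0"])
  then show ?thesis by (simp add: S_dy_E[OF p] delta_def)
qed

lemma S_dy_E_N: "p \<in> U \<Longrightarrow> S (dy k E) p = (\<Sum>s\<in>UNIV. N s k p * dy s E p)"
  using delta_E[of p k] by (simp add: S_dy_E delta_def)

text \<open>The vertical derivative of the Euler-Lagrange equation \<open>S_dy_E\<close>, before it
  is split into its symmetric and antisymmetric parts in \<open>l\<close> and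
  \<open>j\<close>.\<close>

lemma S_fund_aux:
  assumes p: "p \<in> U"
  shows "S (g l j) p + dx j (dy l E) p - 2 * (\<Sum>s\<in>UNIV. N s j p * g l s p) = dx l (dy j E) p"
proof -
  have "dy j (S (dy l E)) p = dy j (dx l E) p"
    unfolding dy_eq[of j] by (rule dir_deriv_eq_on[OF p S_dy_E]) (simp_all add: p)
  also have "\<dots> = dx l (dy j E) p" using p by (simp add: dx_eq dy_eq commute[of E])
  finally have "S (dy j (dy l E)) p + delta F j (dy l E) p - (\<Sum>s\<in>UNIV. N s j p * dy s (dy l E) p)
      = dx l (dy j E) p" using p by (simp add: dy_S)
  moreover have "S (dy j (dy l E)) p = S (g l j) p"
    by (rule S_eq_on[OF p]) (simp_all add: p fund_eq)
  ultimately show ?thesis using p by (simp add: delta_def fund_eq)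
qed

text \<open>Metric compatibility along the spray: in the sum of \<open>S_fund_aux\<close> and its
  copy with exchanged indices the mixed derivatives of \<open>E\<close> cancel.\<close>

lemma S_fund:
  assumes p: "p \<in> U"
  shows "S (g i j) p = (\<Sum>s\<in>UNIV. N s i p * g s j p) + (\<Sum>s\<in>UNIV. N s j p * g i s p)"
proof -
  have "S (g i j) p = S (g j i) p"
    by (rule S_eq_on[OF p fund_sym]) (simp_all add: p)
  moreover have "(\<Sum>s\<in>UNIV. N s i p * g s j p) = (\<Sum>s\<in>UNIV. N s i p * g j s p)"
    using p by (simp add: fund_sym[of p j])
  ultimately show ?thesis using S_fund_aux[OF p, of i j] S_fund_aux[OF p, of j i] by linarith
qed

text \<open>The antisymmetric part of the identity whose symmetric part is \<open>S_fund\<close>.\<close>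

lemma delta_dy_E_sym:
  assumes p: "p \<in> U"
  shows "delta F k (dy j E) p = delta F j (dy k E) p"
proof -
  have "S (g k j) p = S (g j k) p"
    by (rule S_eq_on[OF p fund_sym]) (simp_all add: p)
  then show ?thesis using S_fund_aux[OF p, of k j] S_fund_aux[OF p, of j k] p
    by (simp add: delta_def flip: fund_eq)
qed

abbreviation L where "L \<equiv> D3 C"

text \<open>The Berwald coefficients with the upper index lowered. \<open>X i j k\<close> and
  \<open>X j i k\<close> are the two connection terms in the horizontal covariant derivative of
  \<open>g i j\<close>.\<close>

definition X :: "'n \<Rightarrow> 'n \<Rightarrow> 'n \<Rightarrow> 'n fn" where
  "X i j k p = (\<Sum>s\<in>UNIV. B s i k p * g s j p)"

text \<open>The vertical derivative of \<open>S_fund\<close> is computed by \<open>dy_S\<close> on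
  one side and by the product rule on the other. The terms pairing \<open>N\<close> with
  \<open>C\<close> are exactly those that complete \<open>S (C i j k)\<close> to
  \<open>L i j k\<close>.\<close>

lemma delta_fund:
  assumes p: "p \<in> U"
  shows "delta F k (g i j) p = X i j k p + X j i k p - 2 * L i j k p"
proof -
  let ?h = "\<lambda>q. (\<Sum>s\<in>UNIV. N s i q * g s j q) + (\<Sum>s\<in>UNIV. N s j q * g i s q)"
  have dg: "dy k (g i j) q = 2 * C i j k q" for i j k q
    by (simp add: cartan_def)
  have "dy k (S (g i j)) p = dy k ?h p"
    unfolding dy_eq[of k] by (rule dir_deriv_eq_on[OF p S_fund]) (simp_all add: p)
  also have "\<dots> = (\<Sum>s\<in>UNIV. N s i p * dy k (g s j) p + B s i k p * g s j p)
      + (\<Sum>s\<in>UNIV. N s j p * dy k (g i s) p + B s j k p * g i s p)"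
    using p by (simp add: dy_eq[of k] dir_deriv_rules berwald_def)
  also have "\<dots> = 2 * (\<Sum>s\<in>UNIV. N s i p * C s j k p) + 2 * (\<Sum>s\<in>UNIV. N s j p * C i s k p) + X i j k p + X j i k p"
    using p by (simp add: dg X_def fund_sym[of p i] sum.distrib sum_distrib_left mult_ac)
  finally have "S (dy k (g i j)) p + delta F k (g i j) p - 2 * (\<Sum>s\<in>UNIV. N s k p * C i j s p) =
      2 * (\<Sum>s\<in>UNIV. N s i p * C s j k p) + 2 * (\<Sum>s\<in>UNIV. N s j p * C i s k p) + X i j k p + X j i k p"
    using p by (simp add: dy_S dg sum_distrib_left mult_ac)
  moreover have "S (dy k (g i j)) p = 2 * S (C i j k) p"
    using p S_rules(3)[of "\<lambda>_. 2" p "C i j k"] by (simp add: dg[abs_def])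
  ultimately show ?thesis by (simp add: D3_def)
qed

section \<open>Riemann curvature and the commutator of spray and horizontal derivative\<close>

abbreviation R where "R \<equiv> riemann F"

lemma riemann_eq:
  assumes p: "p \<in> U"
  shows "R s k p = 2 * dx k (G s) p - S (N s k) p - (\<Sum>j\<in>UNIV. N s j p * N j k p)"
  using p by (simp add: riemann_def S_expand)

lemma smooth_riemann [simp]: "smooth_on (R s k) U"
  by (rule smooth_eq_on[OF riemann_eq]) simp_all

text \<open>The bracket of the spray with a horizontal coordinate field; the Riemann curvature is
  its vertical part.\<close>

lemma S_delta_commute:
  assumes p: "p \<in> U" and f: "smooth_on f U"
  shows "S (delta F k f) p = delta F k (S f) p + (\<Sum>s\<in>UNIV. N s k p * delta F s f p)
    + (\<Sum>s\<in>UNIV. R s k p * dy s f p)"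
proof -
  have 1: "S (delta F k f) p = S (dx k f) p - (\<Sum>s\<in>UNIV. N s k p * S (dy s f) p)
      - (\<Sum>s\<in>UNIV. S (N s k) p * dy s f p)"
    using p f by (simp add: delta_def S_rules S_sum sum.distrib)
  \<comment> \<open>The coefficients of the horizontal lift are frozen at \<open>p\<close>, since
    \<open>dir_deriv_S\<close> concerns a constant direction. The derivative of these coefficients
    is accounted for in the last sum of fact 1.\<close>
  have "S (dir_deriv (HV k p) f) p = S (\<lambda>q. dx k f q - (\<Sum>s\<in>UNIV. N s k p * dy s f q)) p"
    by (rule S_eq_on[OF p]) (use p f in \<open>simp_all add: dir_deriv_expand HV_def sum_axis sum_negf\<close>)
  also have "\<dots> = S (dx k f) p - (\<Sum>s\<in>UNIV. N s k p * S (dy s f) p)"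
    using p f by (simp add: S_rules S_sum)
  finally have 2: "delta F k (S f) p = S (dx k f) p - (\<Sum>s\<in>UNIV. N s k p * S (dy s f) p)
      - (\<Sum>i\<in>UNIV. N i k p * dx i f p) - 2 * (\<Sum>i\<in>UNIV. delta F k (G i) p * dy i f p)"
    using dir_deriv_S[OF p f, of "HV k p"] p f
    by (simp add: delta_eq[of "S f"] delta_eq[of "G _"] HV_def sum_negf)
  have NN: "(\<Sum>s\<in>UNIV. N s k p * (\<Sum>r\<in>UNIV. N r s p * dy r f p)) = (\<Sum>s\<in>UNIV. (\<Sum>j\<in>UNIV. N s j p * N j k p) * dy s f p)"
    unfolding sum_distrib_left sum_distrib_right by (subst sum.swap) (simp add: mult_ac)
  have 3: "(\<Sum>s\<in>UNIV. N s k p * delta F s f p) = (\<Sum>i\<in>UNIV. N i k p * dx i f p)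
      - (\<Sum>s\<in>UNIV. (\<Sum>j\<in>UNIV. N s j p * N j k p) * dy s f p)"
    by (simp add: delta_def right_diff_distrib sum_subtractf NN)
  have 4: "delta F k (G s) p = dx k (G s) p - (\<Sum>j\<in>UNIV. N s j p * N j k p)" for s
    by (simp add: delta_def mult.commute)
  have 5: "(\<Sum>s\<in>UNIV. R s k p * dy s f p) = 2 * (\<Sum>s\<in>UNIV. delta F k (G s) p * dy s f p) - (\<Sum>s\<in>UNIV. S (N s k) p * dy s f p)
      + (\<Sum>s\<in>UNIV. (\<Sum>j\<in>UNIV. N s j p * N j k p) * dy s f p)"
    unfolding sum_distrib_left sum_subtractf[symmetric] sum.distrib[symmetric]
    by (rule sum.cong) (simp_all add: riemann_eq[OF p] 4 algebra_simps)
  show ?thesis using 1 2 3 5 by linarith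
qed

text \<open>The derivative of the Berwald coefficients along the spray, corrected as if they were a
  tensor of type (1,2).\<close>

definition DB :: "'n \<Rightarrow> 'n \<Rightarrow> 'n \<Rightarrow> 'n fn" where
  "DB s i k p = S (B s i k) p + (\<Sum>r\<in>UNIV. N s r p * B r i k p)
    - (\<Sum>r\<in>UNIV. N r i p * B s r k p) - (\<Sum>r\<in>UNIV. N r k p * B s i r p)"

lemma DB_sym:
  assumes p: "p \<in> U"
  shows "DB s i k p = DB s k i p"
proof -
  have "S (B s i k) p = S (B s k i) p"
    by (rule S_eq_on[OF p B_sym]) (simp_all add: p)
  then show ?thesis using B_sym[OF p] by (simp add: DB_def)
qed

lemma dy_riemann:
  assumes p: "p \<in> U"
  shows "dy i (R s k) p = 2 * delta F k (N s i) p - delta F i (N s k) p - DB s i k p"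
proof -
  have "dy i (R s k) p = dy i (\<lambda>q. 2 * dx k (G s) q - S (N s k) q - (\<Sum>j\<in>UNIV. N s j q * N j k q)) p"
    unfolding dy_eq[of i] by (rule dir_deriv_eq_on[OF p riemann_eq]) (simp_all add: p)
  also have "\<dots> = 2 * dy i (dx k (G s)) p - dy i (S (N s k)) p
      - (\<Sum>j\<in>UNIV. N s j p * B j k i p) - (\<Sum>j\<in>UNIV. N j k p * B s j i p)"
    using p by (simp add: dy_eq[of i] dir_deriv_rules berwald_def sum.distrib mult.commute)
  also have "dy i (dx k (G s)) p = delta F k (N s i) p + (\<Sum>r\<in>UNIV. N r k p * B s i r p)"
    using p by (simp add: delta_def berwald_def dx_eq dy_eq commute[of "G s"])
  also have "dy i (S (N s k)) p = S (B s k i) p + delta F i (N s k) p - (\<Sum>r\<in>UNIV. N r i p * B s k r p)"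
    using p by (simp add: dy_S berwald_def)
  finally have 1: "dy i (R s k) p = 2 * delta F k (N s i) p - delta F i (N s k) p - (S (B s k i) p
      + (\<Sum>j\<in>UNIV. N s j p * B j k i p) - (\<Sum>r\<in>UNIV. N r i p * B s k r p)
      + (\<Sum>j\<in>UNIV. N j k p * B s j i p) - 2 * (\<Sum>r\<in>UNIV. N r k p * B s i r p))"
    by simp
  have "B s j i p = B s i j p" for j using B_sym[OF p] .
  then have "dy i (R s k) p = 2 * delta F k (N s i) p - delta F i (N s k) p - DB s k i p"
    using 1 by (simp add: DB_def)
  then show ?thesis using DB_sym[OF p] by simp
qed

text \<open>Twice \<open>dy_riemann\<close> plus its copy with \<open>i\<close> and \<open>k\<close>
  exchanged eliminates \<open>delta F i (N s k)\<close>, because \<open>DB\<close> is symmetric in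
  these indices; division by 3 gives the coefficients.\<close>

lemma DB_eq:
  assumes p: "p \<in> U"
  shows "DB s i k p = delta F k (N s i) p - 2/3 * dy i (R s k) p - 1/3 * dy k (R s i) p"
  using dy_riemann[OF p, of i s k] dy_riemann[OF p, of k s i] DB_sym[OF p, of s i k] by linarith

lemma S_X:
  assumes p: "p \<in> U"
  shows "S (X i j k) p = (\<Sum>s\<in>UNIV. DB s i k p * g s j p) + (\<Sum>r\<in>UNIV. N r i p * X r j k p)
    + (\<Sum>r\<in>UNIV. N r k p * X i j r p) + (\<Sum>r\<in>UNIV. N r j p * X i r k p)"
proof -
  have swap: "(\<Sum>s\<in>UNIV. (\<Sum>r\<in>UNIV. a r * b s r) * c s) = (\<Sum>r\<in>UNIV. a r * (\<Sum>s\<in>UNIV. b s r * c s))"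
    for a c :: "'n \<Rightarrow> real" and b
    unfolding sum_distrib_left sum_distrib_right by (subst sum.swap) (simp add: mult_ac)
  have "S (X i j k) p = (\<Sum>s\<in>UNIV. B s i k p * S (g s j) p) + (\<Sum>s\<in>UNIV. S (B s i k) p * g s j p)"
    using p by (simp add: X_def[abs_def] S_sum S_rules sum.distrib)
  also have "(\<Sum>s\<in>UNIV. B s i k p * S (g s j) p) =
      (\<Sum>s\<in>UNIV. B s i k p * (\<Sum>r\<in>UNIV. N r s p * g r j p)) + (\<Sum>s\<in>UNIV. B s i k p * (\<Sum>r\<in>UNIV. N r j p * g s r p))"
    by (simp add: S_fund[OF p] distrib_left sum.distrib)
  also have "(\<Sum>s\<in>UNIV. B s i k p * (\<Sum>r\<in>UNIV. N r j p * g s r p)) = (\<Sum>r\<in>UNIV. N r j p * X i r k p)"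
    unfolding X_def sum_distrib_left by (subst sum.swap) (simp add: mult_ac)
  also have "(\<Sum>s\<in>UNIV. S (B s i k) p * g s j p) = (\<Sum>s\<in>UNIV. DB s i k p * g s j p)
      - (\<Sum>s\<in>UNIV. (\<Sum>r\<in>UNIV. N s r p * B r i k p) * g s j p)
      + (\<Sum>s\<in>UNIV. (\<Sum>r\<in>UNIV. N r i p * B s r k p) * g s j p) + (\<Sum>s\<in>UNIV. (\<Sum>r\<in>UNIV. N r k p * B s i r p) * g s j p)"
    unfolding sum.distrib[symmetric] sum_subtractf[symmetric]
    by (rule sum.cong) (simp_all add: DB_def algebra_simps)
  \<comment> \<open>The correction for the upper index in \<open>DB\<close> cancels one of the two
    sums from \<open>S_fund\<close>; what remains corrects the three lower indices of
    \<open>X\<close>.\<close>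
  also have "(\<Sum>s\<in>UNIV. (\<Sum>r\<in>UNIV. N s r p * B r i k p) * g s j p) = (\<Sum>s\<in>UNIV. B s i k p * (\<Sum>r\<in>UNIV. N r s p * g r j p))"
    unfolding sum_distrib_left sum_distrib_right by (subst sum.swap) (simp add: mult_ac)
  finally show ?thesis by (simp add: swap flip: X_def)
qed

text \<open>\<open>S (delta F k (g i j))\<close> is evaluated twice, from \<open>delta_fund\<close>
  and through the commutator \<open>S_delta_commute\<close>. All terms with \<open>N\<close> and its
  horizontal derivatives cancel or are absorbed in \<open>D3\<close>; halving the coefficients 2/3
  and 1/3 of \<open>DB_eq\<close> gives 1/3 and 1/6.\<close>

lemma D3_landsberg:
  assumes p: "p \<in> U"
  shows "D3 L i j k p + (\<Sum>s\<in>UNIV. C i j s p * R s k p) =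
    - 1/3 * (\<Sum>s\<in>UNIV. g s j p * dy i (R s k) p) - 1/6 * (\<Sum>s\<in>UNIV. g s j p * dy k (R s i) p)
    - 1/3 * (\<Sum>s\<in>UNIV. g s i p * dy j (R s k) p) - 1/6 * (\<Sum>s\<in>UNIV. g s i p * dy k (R s j) p)"
proof -
  have sX: "smooth_on (X i j k) U" for i j k by (simp add: X_def[abs_def])
  have DB: "(\<Sum>s\<in>UNIV. DB s i k p * g s j p) = (\<Sum>s\<in>UNIV. delta F k (N s i) p * g s j p)
      - 2/3 * (\<Sum>s\<in>UNIV. g s j p * dy i (R s k) p) - 1/3 * (\<Sum>s\<in>UNIV. g s j p * dy k (R s i) p)" for i j
    unfolding sum_distrib_left sum_subtractf[symmetric]
    by (rule sum.cong) (simp_all add: DB_eq[OF p] algebra_simps)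
  have sum3: "(\<Sum>s\<in>UNIV. n s * (a s + b s - 2 * c s)) = (\<Sum>s\<in>UNIV. n s * a s) + (\<Sum>s\<in>UNIV. n s * b s) - 2 * (\<Sum>s\<in>UNIV. n s * c s)"
    for n a b c :: "'n \<Rightarrow> real"
    by (simp add: distrib_left right_diff_distrib sum.distrib sum_subtractf sum_distrib_left mult_ac)
  have "S (delta F k (g i j)) p = S (\<lambda>q. X i j k q + X j i k q - 2 * L i j k q) p"
    by (rule S_eq_on[OF p delta_fund]) (simp_all add: p sX)
  also have "\<dots> = S (X i j k) p + S (X j i k) p - 2 * S (L i j k) p"
    using p sX by (simp add: S_rules)
  finally have 1: "S (delta F k (g i j)) p = S (X i j k) p + S (X j i k) p - 2 * S (L i j k) p" .
  have "delta F k (S (g i j)) p = dir_deriv (HV k p) (\<lambda>q. (\<Sum>s\<in>UNIV. N s i q * g s j q) + (\<Sum>s\<in>UNIV. N s j q * g i s q)) p"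
    using p by (subst delta_eq) (simp_all, rule dir_deriv_eq_on[OF p S_fund], simp_all)
  also have "\<dots> = (\<Sum>s\<in>UNIV. N s i p * delta F k (g s j) p + delta F k (N s i) p * g s j p)
      + (\<Sum>s\<in>UNIV. N s j p * delta F k (g i s) p + delta F k (N s j) p * g i s p)"
    using p by (simp add: dir_deriv_rules delta_eq)
  also have "\<dots> = (\<Sum>s\<in>UNIV. N s i p * X s j k p) + (\<Sum>s\<in>UNIV. N s i p * X j s k p) - 2 * (\<Sum>s\<in>UNIV. N s i p * L s j k p)
      + (\<Sum>s\<in>UNIV. N s j p * X i s k p) + (\<Sum>s\<in>UNIV. N s j p * X s i k p) - 2 * (\<Sum>s\<in>UNIV. N s j p * L i s k p)
      + (\<Sum>s\<in>UNIV. delta F k (N s i) p * g s j p) + (\<Sum>s\<in>UNIV. delta F k (N s j) p * g s i p)"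
    by (simp add: delta_fund[OF p] sum.distrib sum3 fund_sym[OF p, of i])
  finally have 2: "delta F k (S (g i j)) p = \<dots>" .
  have 3: "(\<Sum>s\<in>UNIV. N s k p * delta F s (g i j) p) =
      (\<Sum>s\<in>UNIV. N s k p * X i j s p) + (\<Sum>s\<in>UNIV. N s k p * X j i s p) - 2 * (\<Sum>s\<in>UNIV. N s k p * L i j s p)"
    by (simp add: delta_fund[OF p] sum3)
  have 4: "(\<Sum>s\<in>UNIV. R s k p * dy s (g i j) p) = 2 * (\<Sum>s\<in>UNIV. C i j s p * R s k p)"
    by (simp add: cartan_def sum_distrib_left mult_ac)
  have 5: "S (delta F k (g i j)) p = delta F k (S (g i j)) p + (\<Sum>s\<in>UNIV. N s k p * delta F s (g i j) p)
      + (\<Sum>s\<in>UNIV. R s k p * dy s (g i j) p)"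
    by (rule S_delta_commute[OF p]) simp
  show ?thesis
    using 1 2 3 4 5 S_X[OF p, of i j k] S_X[OF p, of j i k] DB[of i j] DB[of j i] D3_def[of L i j k p]
    by argo
qed

section \<open>Scalar flag curvature and generalized P-reducibility\<close>

lemma fund_form_add: "fund_form F p (u + v) w = fund_form F p u w + fund_form F p v w"
  "fund_form F p w (u + v) = fund_form F p w u + fund_form F p w v"
  by (simp_all add: fund_form_def distrib_left distrib_right sum.distrib)

lemma fund_form_scale: "fund_form F p (c *\<^sub>R u) w = c * fund_form F p u w"
  "fund_form F p w (c *\<^sub>R u) = c * fund_form F p w u"
  by (simp_all add: fund_form_def sum_distrib_left mult_ac)

lemma fund_form_sym: "p \<in> U \<Longrightarrow> fund_form F p u v = fund_form F p v u"
  unfolding fund_form_def by (subst sum.swap) (simp add: fund_sym[of p] mult_ac)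

lemma fund_form_y:
  assumes p: "p \<in> U"
  shows "fund_form F p (snd p) u = (\<Sum>j\<in>UNIV. dy j E p * u $ j)"
  using p unfolding fund_form_sym[OF p, of "snd p"]
  by (simp add: fund_form_def fund_y[OF p, symmetric] sum_distrib_left sum_distrib_right mult_ac)

lemma fund_form_y_y: "p \<in> U \<Longrightarrow> fund_form F p (snd p) (snd p) = 2 * E p"
  using euler_E[of p] by (simp add: fund_form_y mult.commute)

text \<open>With \<open>c\<close> the projection coefficient, \<open>u - c y\<close> is the nonzero
  component of \<open>u\<close> orthogonal to \<open>y\<close>; its squared length is the claimed
  expression divided by that of \<open>y\<close>.\<close>

lemma cauchy_schwarz_strict:
  assumes p: "p \<in> U" and u: "u \<notin> span {snd p}"
  shows "fund_form F p (snd p) (snd p) * fund_form F p u u - (fund_form F p (snd p) u)\<^sup>2 > 0"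
proof -
  let ?b = "fund_form F p" and ?y = "snd p"
  define c where "c = ?b ?y u / ?b ?y ?y"
  have yy: "?b ?y ?y > 0" using p by (simp add: fund_form_y_y E_pos)
  have "u + (- c) *\<^sub>R ?y \<noteq> 0"
    using u span_mul[OF span_base[of ?y "{?y}"], of c] by auto
  then have "?b (u + (- c) *\<^sub>R ?y) (u + (- c) *\<^sub>R ?y) > 0"
    using fund_pos p by (simp add: U_def)
  then have "?b u u - 2 * c * ?b ?y u + c * c * ?b ?y ?y > 0"
    by (simp only: fund_form_add fund_form_scale fund_form_sym[OF p, of u ?y]) (simp add: algebra_simps)
  moreover have "?b u u - 2 * c * ?b ?y u + c * c * ?b ?y ?y = (?b ?y ?y * ?b u u - (?b ?y u)\<^sup>2) / ?b ?y ?y"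
    using yy by (simp add: c_def field_simps power2_eq_square)
  ultimately show ?thesis using yy by (simp add: zero_less_divide_iff)
qed

text \<open>Applying \<open>S\<close> to \<open>N_y\<close> yields the contraction of
  \<open>S (N s k)\<close> with \<open>y\<close>, and inserting it into \<open>riemann_eq\<close>
  makes everything cancel.\<close>

lemma riemann_y:
  assumes p: "p \<in> U"
  shows "(\<Sum>k\<in>UNIV. R s k p * snd p $ k) = 0"
proof -
  have "S (\<lambda>q. \<Sum>k\<in>UNIV. N s k q * snd q $ k) p = S (\<lambda>q. 2 * G s q) p"
    by (rule S_eq_on[OF p N_y]) (simp_all add: p)
  then have 1: "(\<Sum>k\<in>UNIV. S (N s k) p * snd p $ k) - 2 * (\<Sum>k\<in>UNIV. N s k p * G k p) = 2 * S (G s) p"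
    using p by (simp add: S_sum S_rules sum_subtractf sum_distrib_left mult_ac)
  have 2: "S (G s) p = (\<Sum>k\<in>UNIV. dx k (G s) p * snd p $ k) - 2 * (\<Sum>k\<in>UNIV. N s k p * G k p)"
    using p by (simp add: S_expand mult.commute)
  have "(\<Sum>k\<in>UNIV. (\<Sum>j\<in>UNIV. N s j p * N j k p) * snd p $ k) =
      (\<Sum>j\<in>UNIV. N s j p * (\<Sum>k\<in>UNIV. N j k p * snd p $ k))"
    unfolding sum_distrib_left sum_distrib_right by (subst sum.swap) (simp add: mult_ac)
  also have "\<dots> = 2 * (\<Sum>k\<in>UNIV. N s k p * G k p)"
    by (simp only: N_y[OF p]) (simp add: sum_distrib_left mult_ac)
  finally have 3: "(\<Sum>k\<in>UNIV. (\<Sum>j\<in>UNIV. N s j p * N j k p) * snd p $ k) = 2 * (\<Sum>k\<in>UNIV. N s k p * G k p)" .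
  have "(\<Sum>k\<in>UNIV. R s k p * snd p $ k) = 2 * (\<Sum>k\<in>UNIV. dx k (G s) p * snd p $ k)
      - (\<Sum>k\<in>UNIV. S (N s k) p * snd p $ k) - (\<Sum>k\<in>UNIV. (\<Sum>j\<in>UNIV. N s j p * N j k p) * snd p $ k)"
    unfolding sum_distrib_left sum_subtractf[symmetric]
    by (rule sum.cong) (simp_all add: riemann_eq[OF p] left_diff_distrib)
  then show ?thesis using 1 2 3 by linarith
qed

text \<open>Commuting \<open>S\<close> with \<open>delta\<close> on \<open>dy j E\<close> writes the
  lowered curvature as a sum of three terms, each symmetric in \<open>j\<close> and
  \<open>k\<close>: by \<open>delta_dy_E_sym\<close>, by equality of mixed partial derivatives, and
  by symmetry of \<open>g\<close>.\<close>

lemma riemann_sym: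
  assumes p: "p \<in> U"
  shows "(\<Sum>s\<in>UNIV. g j s p * R s k p) = (\<Sum>s\<in>UNIV. g k s p * R s j p)"
proof -
  let ?H = "\<lambda>k j. delta F k (dy j E)"
  let ?NN = "\<lambda>k j. \<Sum>s\<in>UNIV. N s k p * (\<Sum>r\<in>UNIV. N r j p * g s r p)"
  have *: "(\<Sum>s\<in>UNIV. g j s p * R s k p) = S (?H k j) p - dx k (dx j E) p + ?NN k j" for j k
  proof -
    have "delta F k (S (dy j E)) p = dir_deriv (HV k p) (dx j E) p"
      using p by (subst delta_eq) (simp_all, rule dir_deriv_eq_on[OF p S_dy_E], simp_all)
    also have "\<dots> = dx k (dx j E) p - (\<Sum>s\<in>UNIV. N s k p * dy s (dx j E) p)"
      using p by (simp add: delta_def flip: delta_eq)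
    also have "(\<Sum>s\<in>UNIV. N s k p * dy s (dx j E) p) = (\<Sum>s\<in>UNIV. N s k p * ?H s j p) + ?NN k j"
    proof -
      have "dy s (dx j E) p = ?H s j p + (\<Sum>r\<in>UNIV. N r j p * g s r p)" for s
      proof -
        have "dy s (dx j E) p = dx j (dy s E) p" using p by (simp add: dx_eq dy_eq commute[of E])
        also have "\<dots> = ?H j s p + (\<Sum>r\<in>UNIV. N r j p * g s r p)" by (simp add: delta_def fund_eq[OF p])
        finally show ?thesis by (simp only: delta_dy_E_sym[OF p, of j s])
      qed
      then show ?thesis by (simp add: distrib_left sum.distrib)
    qed
    moreover have "S (?H k j) p = delta F k (S (dy j E)) p + (\<Sum>s\<in>UNIV. N s k p * ?H s j p)
        + (\<Sum>s\<in>UNIV. R s k p * dy s (dy j E) p)"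
      by (rule S_delta_commute[OF p]) simp
    moreover have "(\<Sum>s\<in>UNIV. R s k p * dy s (dy j E) p) = (\<Sum>s\<in>UNIV. g j s p * R s k p)"
      by (simp add: fund_eq[OF p] mult.commute)
    ultimately show ?thesis by linarith
  qed
  have "S (?H k j) p = S (?H j k) p"
    by (rule S_eq_on[OF p delta_dy_E_sym]) (simp_all add: p)
  moreover have "dx k (dx j E) p = dx j (dx k E) p"
    using p by (simp add: dx_eq commute[of E])
  moreover have "?NN k j = ?NN j k"
    unfolding sum_distrib_left by (subst sum.swap) (simp add: fund_sym[OF p] mult_ac)
  ultimately show ?thesis using *[of j k] *[of k j] by simp
qed

text \<open>After lowering the index both sides are symmetric, by \<open>riemann_sym\<close>, so it
  suffices to compare quadratic forms, and these are what the flag curvature measures.\<close>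

lemma riemann_scalar_flag:
  assumes p: "p \<in> U" and K: "\<And>u. u \<notin> span {snd p} \<Longrightarrow> flag_curvature F p u = \<kappa>"
  shows "R s k p = \<kappa> * (2 * E p * (if s = k then 1 else 0) - snd p $ s * dy k E p)"
proof (rule fund_inject[OF p, where u = "\<lambda>s. R s k p"
      and v = "\<lambda>s. \<kappa> * (2 * E p * (if s = k then 1 else 0) - snd p $ s * dy k E p)"])
  let ?A = "\<lambda>j k. (\<Sum>s\<in>UNIV. g j s p * R s k p) - \<kappa> * (2 * E p * g j k p - dy j E p * dy k E p)"
  let ?b = "fund_form F p" and ?y = "snd p"
  have A: "?A j k = 0" for j k
  proof (rule symmetric_form_eq_0[of ?A])
    show "?A i j = ?A j i" for i j
      using riemann_sym[OF p, of i j] fund_sym[OF p, of i j] by simp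
    fix u :: "real^'n"
    have 1: "(\<Sum>i\<in>UNIV. \<Sum>j\<in>UNIV. (\<Sum>s\<in>UNIV. g i s p * R s j p) * u $ i * u $ j) = ?b u (riemann_map F p u)"
    proof -
      have "(\<Sum>j\<in>UNIV. (\<Sum>s\<in>UNIV. g i s p * R s j p) * u $ i * u $ j) =
          (\<Sum>s\<in>UNIV. g i s p * u $ i * (\<Sum>j\<in>UNIV. R s j p * u $ j))" for i
        unfolding sum_distrib_left sum_distrib_right by (subst sum.swap) (simp add: mult_ac)
      then show ?thesis by (simp add: fund_form_def riemann_map_def)
    qed
    have 2: "(\<Sum>i\<in>UNIV. \<Sum>j\<in>UNIV. dy i E p * dy j E p * u $ i * u $ j) = (?b ?y u)\<^sup>2"
      by (simp add: fund_form_y[OF p] power2_eq_square sum_product mult_ac)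
    have 3: "?b u u = (\<Sum>i\<in>UNIV. \<Sum>j\<in>UNIV. g i j p * u $ i * u $ j)"
      by (simp add: fund_form_def)
    have "(\<Sum>i\<in>UNIV. \<Sum>j\<in>UNIV. ?A i j * u $ i * u $ j) =
        ?b u (riemann_map F p u) - \<kappa> * (2 * E p * ?b u u - (?b ?y u)\<^sup>2)"
      unfolding 1[symmetric] 2[symmetric] 3 sum_distrib_left sum_subtractf[symmetric]
      by (intro sum.cong refl) (simp add: algebra_simps)
    also have "\<dots> = 0"
    proof (cases "u \<in> span {?y}")
      \<comment> \<open>On the line of \<open>y\<close> there is no flag, but both sides vanish: the
        curvature by \<open>riemann_y\<close>, the other form by equality in Cauchy-Schwarz.\<close>
      case True
      then obtain c where u: "u = c *\<^sub>R ?y" by (auto simp: span_singleton)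
      have "(\<Sum>k\<in>UNIV. R i k p * (c * ?y $ k)) = c * (\<Sum>k\<in>UNIV. R i k p * ?y $ k)" for i
        by (simp add: sum_distrib_left mult_ac)
      then have "riemann_map F p u = 0"
        by (simp add: riemann_map_def vec_eq_iff u riemann_y[OF p])
      moreover have "2 * E p * ?b u u - (?b ?y u)\<^sup>2 = 0"
        by (simp add: u fund_form_scale fund_form_y_y[OF p] power2_eq_square)
      ultimately show ?thesis by (simp add: fund_form_def)
    next
      case False
      show ?thesis
        using K[OF False] cauchy_schwarz_strict[OF p False]
        by (simp add: flag_curvature_def fund_form_y_y[OF p] field_simps)
    qed
    finally show "(\<Sum>i\<in>UNIV. \<Sum>j\<in>UNIV. ?A i j * u $ i * u $ j) = 0" .
  qed
  fix l
  have "(\<Sum>i\<in>UNIV. g l i p * (\<kappa> * (2 * E p * (if i = k then 1 else 0) - ?y $ i * dy k E p))) =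
      \<kappa> * (2 * E p * (\<Sum>i\<in>UNIV. g l i p * (if i = k then 1 else 0)) - (\<Sum>i\<in>UNIV. g l i p * ?y $ i) * dy k E p)"
    unfolding sum_distrib_left sum_distrib_right sum_subtractf[symmetric]
    by (intro sum.cong refl) (simp add: algebra_simps)
  also have "\<dots> = (\<Sum>i\<in>UNIV. g l i p * R i k p)"
    using A[of l k] by (simp add: fund_y[OF p] if_distrib cong: if_cong)
  finally show "(\<Sum>i\<in>UNIV. g l i p * R i k p) =
      (\<Sum>i\<in>UNIV. g l i p * (\<kappa> * (2 * E p * (if i = k then 1 else 0) - ?y $ i * dy k E p)))" by simp
qed

section \<open>The angular metric and its traces\<close>

abbreviation h where "h \<equiv> angular F"

lemma angular_eq: "p \<in> U \<Longrightarrow> h i j p = g i j p - dy i E p * dy j E p * (1 / (2 * E p))"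
  by (simp add: angular_def y_low_eq E_def)

lemma smooth_angular [simp]: "smooth_on (h i j) U"
proof (rule smooth_eq_on[OF angular_eq])
  have "2 * E q \<noteq> 0" if "q \<in> U" for q using E_pos[OF that] by simp
  then show "smooth_on (\<lambda>p. g i j p - dy i E p * dy j E p * (1 / (2 * E p))) U" by simp
qed

lemma angular_sym: "p \<in> U \<Longrightarrow> h i j p = h j i p"
  by (simp add: angular_eq fund_sym[of p i j])

lemma angular_y: "p \<in> U \<Longrightarrow> (\<Sum>j\<in>UNIV. h i j p * snd p $ j) = 0"
proof -
  assume p: "p \<in> U"
  have "(\<Sum>j\<in>UNIV. h i j p * snd p $ j) = (\<Sum>j\<in>UNIV. g i j p * snd p $ j)
      - dy i E p * (1 / (2 * E p)) * (\<Sum>j\<in>UNIV. snd p $ j * dy j E p)"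
    unfolding sum_distrib_left sum_subtractf[symmetric]
    by (intro sum.cong refl) (simp add: angular_eq[OF p] algebra_simps)
  then show ?thesis using E_pos[OF p] by (simp add: fund_y[OF p] euler_E[OF p])
qed

text \<open>\<open>D h = 0\<close>: the metric and \<open>dy i E\<close> are parallel along the
  spray, by \<open>S_fund\<close> and \<open>S_dy_E_N\<close>, and the factor
  \<open>1 / (2 * E)\<close> is constant along it by \<open>S_E\<close>.\<close>

lemma S_angular:
  assumes p: "p \<in> U"
  shows "S (h i j) p = (\<Sum>s\<in>UNIV. N s i p * h s j p) + (\<Sum>s\<in>UNIV. N s j p * h i s p)"
proof -
  have E0: "2 * E q \<noteq> 0" if "q \<in> U" for q using E_pos[OF that] by simp
  define r where "r q = 1 / (2 * E q)" for q
  have "smooth_on r U"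
    unfolding r_def[abs_def] using E0 by simp
  then have dr: "r differentiable (at p)" using p by simp
  have "S r p = 0"
    using p E_pos[OF p] S_E[OF p] S_rules(3)[of "\<lambda>_. 2" p E]
    unfolding S_def r_def[abs_def] by (subst dir_deriv_divide) simp_all
  moreover have "S (h i j) p = S (\<lambda>q. g i j q - dy i E q * dy j E q * r q) p"
  proof (rule S_eq_on[OF p])
    show "h i j q = g i j q - dy i E q * dy j E q * r q" if "q \<in> U" for q
      using that by (simp add: angular_eq r_def)
    show "(\<lambda>q. g i j q - dy i E q * dy j E q * r q) differentiable (at p)"
      using p dr by simp
  qed
  ultimately have "S (h i j) p = S (g i j) p - (dy i E p * S (dy j E) p + S (dy i E) p * dy j E p) * r p"
    using p dr by (simp add: S_rules)
  also have "r p = 1 / (2 * E p)" by (simp add: r_def)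
  also have "S (g i j) p - (dy i E p * S (dy j E) p + S (dy i E) p * dy j E p) * (1 / (2 * E p)) =
      (\<Sum>s\<in>UNIV. N s i p * h s j p) + (\<Sum>s\<in>UNIV. N s j p * h i s p)"
  proof -
    have "(\<Sum>s\<in>UNIV. N s i p * h s j p) = (\<Sum>s\<in>UNIV. N s i p * g s j p) - (\<Sum>s\<in>UNIV. N s i p * dy s E p) * dy j E p * (1 / (2 * E p))"
      "(\<Sum>s\<in>UNIV. N s j p * h i s p) = (\<Sum>s\<in>UNIV. N s j p * g i s p) - (\<Sum>s\<in>UNIV. N s j p * dy s E p) * dy i E p * (1 / (2 * E p))"
      unfolding sum_distrib_right sum_subtractf[symmetric]
      by (intro sum.cong refl; simp add: angular_eq[OF p] algebra_simps)+
    then show ?thesis by (simp add: S_fund[OF p] S_dy_E_N[OF p] algebra_simps)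
  qed
  finally show ?thesis .
qed

text \<open>Raising an index of \<open>h\<close> gives the projection along \<open>y\<close>. The
  second contraction uses the symmetry of \<open>g\<close> in place of that of
  \<open>g'\<close>.\<close>

lemma angular_contract:
  assumes p: "p \<in> U"
  shows "(\<Sum>k\<in>UNIV. g' j k p * h k i p) = (if j = i then 1 else 0) - snd p $ j * dy i E p * (1 / (2 * E p))"
    "(\<Sum>j\<in>UNIV. g' j k p * h i j p) = (if k = i then 1 else 0) - snd p $ k * dy i E p * (1 / (2 * E p))"
proof -
  have r1: "(\<Sum>k\<in>UNIV. g' j k p * dy k E p) = snd p $ j"
  proof -
    have "(\<Sum>k\<in>UNIV. g' j k p * dy k E p) = (\<Sum>i\<in>UNIV. (\<Sum>k\<in>UNIV. g' j k p * g k i p) * snd p $ i)"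
      unfolding fund_y[OF p, symmetric] sum_distrib_left sum_distrib_right
      by (subst sum.swap) (simp add: mult_ac)
    then show ?thesis by (simp add: fund_inv[OF p] if_distrib if_distribR cong: if_cong)
  qed
  have r2: "(\<Sum>j\<in>UNIV. g' j k p * dy j E p) = snd p $ k"
  proof -
    have "(\<Sum>j\<in>UNIV. g' j k p * dy j E p) = (\<Sum>i\<in>UNIV. (\<Sum>j\<in>UNIV. g i j p * g' j k p) * snd p $ i)"
      unfolding fund_y[OF p, symmetric] sum_distrib_left sum_distrib_right
      by (subst sum.swap) (simp add: fund_sym[OF p] mult_ac)
    then show ?thesis by (simp add: fund_inv[OF p] if_distrib if_distribR cong: if_cong)
  qed
  have "(\<Sum>k\<in>UNIV. g' j k p * h k i p) = (\<Sum>k\<in>UNIV. g' j k p * g k i p) - (\<Sum>k\<in>UNIV. g' j k p * dy k E p) * dy i E p * (1 / (2 * E p))"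
    unfolding sum_distrib_right sum_subtractf[symmetric]
    by (intro sum.cong refl) (simp add: angular_eq[OF p] algebra_simps)
  then show "(\<Sum>k\<in>UNIV. g' j k p * h k i p) = (if j = i then 1 else 0) - snd p $ j * dy i E p * (1 / (2 * E p))"
    by (simp only: fund_inv[OF p] r1)
  have "(\<Sum>j\<in>UNIV. g' j k p * h i j p) = (\<Sum>j\<in>UNIV. g i j p * g' j k p) - (\<Sum>j\<in>UNIV. g' j k p * dy j E p) * dy i E p * (1 / (2 * E p))"
    unfolding sum_distrib_right sum_subtractf[symmetric]
    by (intro sum.cong refl) (simp add: angular_eq[OF p] algebra_simps)
  then show "(\<Sum>j\<in>UNIV. g' j k p * h i j p) = (if k = i then 1 else 0) - snd p $ k * dy i E p * (1 / (2 * E p))"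
    by (simp add: fund_inv[OF p] r2 eq_commute)
qed

text \<open>The trace of \<open>h\<close> is \<open>n - 1\<close>, and each of the other two
  summands returns \<open>b i\<close> minus its part along \<open>y\<close>, whence the factor
  \<open>n + 1\<close>.\<close>

lemma angular_trace:
  fixes b :: "'n \<Rightarrow> real"
  assumes p: "p \<in> U"
  shows "(\<Sum>j\<in>UNIV. \<Sum>k\<in>UNIV. g' j k p * (b i * h j k p + b j * h k i p + b k * h i j p)) =
    (real CARD('n) + 1) * b i - dy i E p / E p * (\<Sum>k\<in>UNIV. b k * snd p $ k)"
proof -
  let ?\<beta> = "\<Sum>k\<in>UNIV. b k * snd p $ k"
  have E: "E p > 0" by (rule E_pos[OF p])
  have "(\<Sum>j\<in>UNIV. \<Sum>k\<in>UNIV. g' j k p * h j k p) = (\<Sum>j\<in>UNIV. \<Sum>k\<in>UNIV. g' j k p * h k j p)"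
    by (simp only: angular_sym[OF p])
  also have "\<dots> = real CARD('n) - (\<Sum>j\<in>UNIV. snd p $ j * dy j E p) * (1 / (2 * E p))"
    by (simp only: angular_contract[OF p] sum_subtractf sum_distrib_right) simp
  also have "\<dots> = real CARD('n) - 1"
    using E by (simp add: euler_E[OF p])
  finally have 1: "(\<Sum>j\<in>UNIV. \<Sum>k\<in>UNIV. g' j k p * h j k p) = real CARD('n) - 1" .
  have b: "(\<Sum>j\<in>UNIV. b j * ((if j = i then 1 else 0) - snd p $ j * dy i E p * (1 / (2 * E p)))) =
      b i - dy i E p * (1 / (2 * E p)) * ?\<beta>"
  proof -
    have "(\<Sum>j\<in>UNIV. b j * ((if j = i then 1 else 0) - snd p $ j * dy i E p * (1 / (2 * E p)))) =
      (\<Sum>j\<in>UNIV. b j * (if j = i then 1 else 0)) - dy i E p * (1 / (2 * E p)) * ?\<beta>"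
      unfolding sum_distrib_left sum_subtractf[symmetric]
      by (intro sum.cong refl) (simp add: algebra_simps)
    then show ?thesis by (simp add: if_distrib cong: if_cong)
  qed
  have "(\<Sum>j\<in>UNIV. \<Sum>k\<in>UNIV. g' j k p * (b i * h j k p + b j * h k i p + b k * h i j p)) =
      b i * (\<Sum>j\<in>UNIV. \<Sum>k\<in>UNIV. g' j k p * h j k p) + (\<Sum>j\<in>UNIV. b j * (\<Sum>k\<in>UNIV. g' j k p * h k i p))
      + (\<Sum>j\<in>UNIV. \<Sum>k\<in>UNIV. b k * (g' j k p * h i j p))"
    by (simp add: distrib_left sum.distrib sum_distrib_left mult_ac)
  also have "(\<Sum>j\<in>UNIV. \<Sum>k\<in>UNIV. b k * (g' j k p * h i j p)) = (\<Sum>k\<in>UNIV. b k * (\<Sum>j\<in>UNIV. g' j k p * h i j p))"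
    unfolding sum_distrib_left by (rule sum.swap)
  also have "b i * (\<Sum>j\<in>UNIV. \<Sum>k\<in>UNIV. g' j k p * h j k p) + (\<Sum>j\<in>UNIV. b j * (\<Sum>k\<in>UNIV. g' j k p * h k i p)) + \<dots> =
      b i * (real CARD('n) - 1) + 2 * (b i - dy i E p * (1 / (2 * E p)) * ?\<beta>)"
    unfolding 1 angular_contract[OF p] b by simp
  also have "\<dots> = (real CARD('n) + 1) * b i - dy i E p / E p * ?\<beta>"
    using E by (simp add: field_simps)
  finally show ?thesis .
qed

section \<open>The derivative of the Landsberg curvature in two ways\<close>

lemma scalar_flag_curvature_smooth:
  assumes n: "CARD('n) \<ge> 2"
    and K: "\<And>p u. p \<in> U \<Longrightarrow> u \<notin> span {snd p} \<Longrightarrow> flag_curvature F p u = K p"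
  shows "smooth_on K U"
proof (rule smooth_eq_on)
  fix p assume p: "p \<in> U"
  \<comment> \<open>The trace of the curvature is \<open>2 * E p * K p * (n - 1)\<close>, so for
    \<open>n \<ge> 2\<close> division exhibits \<open>K\<close> as a smooth function.\<close>
  have "(\<Sum>s\<in>UNIV. R s s p) = K p * (2 * E p * real CARD('n) - (\<Sum>s\<in>UNIV. snd p $ s * dy s E p))"
    by (simp add: riemann_scalar_flag[OF p K[OF p]] sum_subtractf mult_ac flip: sum_distrib_left)
  then show "K p = (\<Sum>s\<in>UNIV. R s s p) / (2 * E p * (real CARD('n) - 1))"
    using n E_pos[OF p] by (simp add: euler_E[OF p] field_simps)
next
  have "2 * E q * (real CARD('n) - 1) \<noteq> 0" if "q \<in> U" for q using E_pos[OF that] n by simp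
  then show "smooth_on (\<lambda>p. (\<Sum>s\<in>UNIV. R s s p) / (2 * E p * (real CARD('n) - 1))) U"
    by simp
qed

text \<open>\<open>D3_landsberg\<close> is evaluated for the curvature of
  \<open>riemann_scalar_flag\<close>. On its right side the weights 1/3 and 1/6 make all terms with
  undifferentiated \<open>K\<close> cancel; derivatives of \<open>K\<close> survive only multiplied
  by \<open>2 * E * h\<close>.\<close>

lemma D3_landsberg_scalar_flag:
  assumes p: "p \<in> U" and sK: "smooth_on K U"
    and K: "\<And>p u. p \<in> U \<Longrightarrow> u \<notin> span {snd p} \<Longrightarrow> flag_curvature F p u = K p"
  shows "D3 L i j k p + 2 * E p * K p * C i j k p =
    - 2/3 * E p * (dy i K p * h j k p + dy j K p * h k i p + dy k K p * h i j p)"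
proof -
  let ?d = "\<lambda>s k. if s = k then 1 else 0 :: real"
  have R: "R s k q = K q * (2 * E q * ?d s k - snd q $ s * dy k E q)" if "q \<in> U" for q s k
    using riemann_scalar_flag[OF that K[OF that]] .
  have T: "(\<Sum>s\<in>UNIV. g s j p * dy i (R s k) p) = dy i K p * (2 * E p * g k j p - dy j E p * dy k E p)
      + K p * (2 * dy i E p * g k j p - g i j p * dy k E p - dy j E p * g k i p)" for i j k
  proof -
    have dR: "dy i (R s k) p = dy i K p * (2 * E p * ?d s k - snd p $ s * dy k E p)
        + K p * (2 * dy i E p * ?d s k - axis i 1 $ s * dy k E p - snd p $ s * g k i p)" for s
    proof -
      have "dy i (R s k) p = dy i (\<lambda>q. K q * (2 * E q * ?d s k - snd q $ s * dy k E q)) p"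
        unfolding dy_eq[of i] by (rule dir_deriv_eq_on[OF p R]) (use p sK in simp_all)
      also have "\<dots> = dy i K p * (2 * E p * ?d s k - snd p $ s * dy k E p)
        + K p * (2 * dy i E p * ?d s k - axis i 1 $ s * dy k E p - snd p $ s * dy i (dy k E) p)"
        using p sK by (simp add: dy_eq[of i] dir_deriv_rules del: mult_cancel_left mult_cancel_right)
      finally show ?thesis by (simp only: fund_eq[OF p])
    qed
    have "(\<Sum>s\<in>UNIV. g s j p * dy i (R s k) p) =
        dy i K p * (2 * E p * (\<Sum>s\<in>UNIV. g s j p * ?d s k) - (\<Sum>s\<in>UNIV. g j s p * snd p $ s) * dy k E p)
        + K p * (2 * dy i E p * (\<Sum>s\<in>UNIV. g s j p * ?d s k) - (\<Sum>s\<in>UNIV. g s j p * axis i 1 $ s) * dy k E p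
          - (\<Sum>s\<in>UNIV. g j s p * snd p $ s) * g k i p)"
      unfolding sum_distrib_left sum_distrib_right sum_subtractf[symmetric] sum.distrib[symmetric]
      by (intro sum.cong refl) (simp only: dR fund_sym[OF p, of j] algebra_simps)
    then show ?thesis by (simp add: fund_y[OF p] sum_axis if_distrib cong: if_cong)
  qed
  have "(\<Sum>s\<in>UNIV. C i j s p * R s k p) = K p * (2 * E p * (\<Sum>s\<in>UNIV. C i j s p * ?d s k)
      - (\<Sum>s\<in>UNIV. C i j s p * snd p $ s) * dy k E p)"
    unfolding sum_distrib_left sum_distrib_right sum_subtractf[symmetric]
    by (intro sum.cong refl) (simp only: R[OF p] algebra_simps)
  then have CR: "(\<Sum>s\<in>UNIV. C i j s p * R s k p) = 2 * E p * K p * C i j k p"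
    by (simp add: cartan_y[OF p] if_distrib cong: if_cong)
  have h: "2 * E p * h a b p = 2 * E p * g a b p - dy a E p * dy b E p" for a b
    using E_pos[OF p] by (simp add: angular_eq[OF p] field_simps)
  have s: "g j i p = g i j p" "g k j p = g j k p" "g k i p = g i k p" "h k i p = h i k p"
    by (simp_all only: fund_sym[OF p, of j i] fund_sym[OF p, of k] angular_sym[OF p, of k])
  have "- 2/3 * E p * (dy i K p * h j k p + dy j K p * h k i p + dy k K p * h i j p) =
      - 1/3 * (dy i K p * (2 * E p * h j k p) + dy j K p * (2 * E p * h i k p) + dy k K p * (2 * E p * h i j p))"
    by (simp add: s algebra_simps)
  then show ?thesis
    using D3_landsberg[OF p, of i j k] unfolding CR T h s by (simp add: algebra_simps)
qed

text \<open>\<open>D3\<close> acts as a derivation and annihilates \<open>h\<close>, so only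
  \<open>lam\<close>, \<open>C\<close> and \<open>a\<close> are differentiated; \<open>Da\<close> is
  the covariant derivative of \<open>a\<close> along the spray.\<close>

lemma D3_generalized_P_reducible:
  assumes p: "p \<in> U"
    and lam: "lam differentiable (at p)" and a: "\<And>i. a i differentiable (at p)"
    and L: "\<And>q i j k. q \<in> U \<Longrightarrow> L i j k q =
      lam q * C i j k q + a i q * h j k q + a j q * h k i q + a k q * h i j q"
  defines "Da i \<equiv> S (a i) p - (\<Sum>s\<in>UNIV. N s i p * a s p)"
  shows "D3 L i j k p = S lam p * C i j k p + lam p * L i j k p
    + Da i * h j k p + Da j * h k i p + Da k * h i j p"
proof -
  have e: "(\<Sum>s\<in>UNIV. n s * (l * c s + x s * u + v * y s + w * z s)) =
      l * (\<Sum>s\<in>UNIV. n s * c s) + (\<Sum>s\<in>UNIV. n s * x s) * u + v * (\<Sum>s\<in>UNIV. n s * y s) + w * (\<Sum>s\<in>UNIV. n s * z s)"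
    for n c x y z :: "'n \<Rightarrow> real" and l u v w
    by (simp add: distrib_left sum.distrib sum_distrib_left sum_distrib_right mult_ac)
  have "S (L i j k) p = S (\<lambda>q. lam q * C i j k q + a i q * h j k q + a j q * h k i q + a k q * h i j q) p"
    by (rule S_eq_on[OF p L]) (use p lam a in simp_all)
  also have "\<dots> = S lam p * C i j k p + lam p * S (C i j k) p + S (a i) p * h j k p + a i p * S (h j k) p
      + S (a j) p * h k i p + a j p * S (h k i) p + S (a k) p * h i j p + a k p * S (h i j) p"
    using p lam a by (simp add: S_rules)
  finally have 1: "S (L i j k) p = \<dots>" .
  have 2: "(\<Sum>s\<in>UNIV. N s i p * L s j k p) = lam p * (\<Sum>s\<in>UNIV. N s i p * C s j k p)
      + (\<Sum>s\<in>UNIV. N s i p * a s p) * h j k p + a j p * (\<Sum>s\<in>UNIV. N s i p * h k s p) + a k p * (\<Sum>s\<in>UNIV. N s i p * h s j p)"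
    unfolding L[OF p] by (rule e)
  have 3: "(\<Sum>s\<in>UNIV. N s j p * L i s k p) = lam p * (\<Sum>s\<in>UNIV. N s j p * C i s k p)
      + (\<Sum>s\<in>UNIV. N s j p * a s p) * h k i p + a i p * (\<Sum>s\<in>UNIV. N s j p * h s k p) + a k p * (\<Sum>s\<in>UNIV. N s j p * h i s p)"
    unfolding e[symmetric] by (intro sum.cong refl) (simp only: L[OF p] algebra_simps)
  have 4: "(\<Sum>s\<in>UNIV. N s k p * L i j s p) = lam p * (\<Sum>s\<in>UNIV. N s k p * C i j s p)
      + (\<Sum>s\<in>UNIV. N s k p * a s p) * h i j p + a i p * (\<Sum>s\<in>UNIV. N s k p * h j s p) + a j p * (\<Sum>s\<in>UNIV. N s k p * h s i p)"
    unfolding e[symmetric] by (intro sum.cong refl) (simp only: L[OF p] algebra_simps)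
  \<comment> \<open>Solving the definition of \<open>L\<close> for \<open>S (C i j k)\<close> turns
    the differentiated \<open>C\<close> back into \<open>L\<close>.\<close>
  have 5: "S (C i j k) p = L i j k p + (\<Sum>s\<in>UNIV. N s i p * C s j k p)
     + (\<Sum>s\<in>UNIV. N s j p * C i s k p) + (\<Sum>s\<in>UNIV. N s k p * C i j s p)"
    by (simp add: D3_def)
  show ?thesis
    unfolding D3_def[of L i j k p] 1 2 3 4 5 S_angular[OF p] Da_def
    by (simp add: algebra_simps)
qed

section \<open>From an angular form of the Cartan torsion to C-reducibility\<close>

lemma matsumoto_eq_0I:
  assumes p: "p \<in> U"
    and C: "\<And>i j k. C i j k p = c i * h j k p + c j * h k i p + c k * h i j p"
  shows "matsumoto F i j k p = 0"
proof -
  let ?\<beta> = "\<Sum>k\<in>UNIV. c k * snd p $ k" and ?n = "real CARD('n) + 1"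
  \<comment> \<open>Contracting the assumed form of \<open>C\<close> with \<open>y\<close> leaves
    only this term. The product with \<open>h\<close> is all that the trace needs, and it also
    covers dimension one, where \<open>h\<close> vanishes.\<close>
  have \<beta>: "?\<beta> * h i j p = 0" for i j
  proof -
    have "(\<Sum>k\<in>UNIV. C i j k p * snd p $ k) = c i * (\<Sum>k\<in>UNIV. h j k p * snd p $ k)
        + c j * (\<Sum>k\<in>UNIV. h i k p * snd p $ k) + ?\<beta> * h i j p"
      unfolding sum_distrib_left sum_distrib_right sum.distrib[symmetric]
      by (intro sum.cong refl) (simp add: C angular_sym[OF p, of i] algebra_simps)
    then show ?thesis by (simp add: angular_y[OF p] cartan_y[OF p])
  qed
  have I: "mean_cartan F i p = ?n * c i - dy i E p / E p * ?\<beta>" for i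
    unfolding mean_cartan_def C by (rule angular_trace[OF p])
  have Ih: "mean_cartan F i p * h j k p = ?n * (c i * h j k p)" for i j k
    using \<beta>[of j k] by (simp add: I left_diff_distrib del: mult_eq_0_iff)
  have "?n \<noteq> 0" by simp
  then show ?thesis
    unfolding matsumoto_def Ih distrib_left[symmetric]
    by (simp add: C angular_sym[OF p, of i k])
qed

text \<open>There are no flags in dimension one, so this case is treated separately:
  \<open>cartan_y\<close> has a single summand, and the only component of \<open>y\<close> is
  nonzero.\<close>

lemma matsumoto_eq_0_dim_1:
  assumes p: "p \<in> U" and n: "CARD('n) = 1"
  shows "matsumoto F i j k p = 0"
proof -
  obtain a :: 'n where a: "UNIV = {a}" using n by (auto simp: card_1_singleton_iff)
  have eq: "x = a" for x :: 'n using a by blast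
  have "C i j k p * snd p $ a = 0" for i j k
    using cartan_y[OF p, of i j] unfolding a by (simp add: eq[of k])
  moreover have "snd p $ a \<noteq> 0"
    using p eq by (auto simp: U_def vec_eq_iff) metis
  ultimately have "C i j k p = 0" for i j k by simp
  then show ?thesis by (simp add: matsumoto_def mean_cartan_def)
qed

text \<open>The covector \<open>a\<close> is not assumed to be differentiable; it is recovered from the trace of \<open>L\<close>.\<close>

lemma differentiable_of_trace:
  assumes p: "p \<in> U" and lam: "lam differentiable (at p)"
    and L: "\<And>q i j k. q \<in> U \<Longrightarrow> L i j k q =
      lam q * C i j k q + a i q * h j k q + a j q * h k i q + a k q * h i j q"
    and ay: "\<And>q. q \<in> U \<Longrightarrow> (\<Sum>i\<in>UNIV. a i q * snd q $ i) = 0"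
  shows "a i differentiable (at p)"
proof -
  \<comment> \<open>Solving the trace of the formula for \<open>L\<close> for \<open>a i\<close>; by
    \<open>ay\<close> the last term of \<open>angular_trace\<close> drops out.\<close>
  let ?f = "\<lambda>q. ((\<Sum>j\<in>UNIV. \<Sum>k\<in>UNIV. g' j k q * L i j k q) - lam q * mean_cartan F i q) / (real CARD('n) + 1)"
  have "smooth_on (mean_cartan F i) U" by (simp add: mean_cartan_def[abs_def])
  then have d: "?f differentiable (at p)"
    using p by (intro differentiable_divide differentiable_diff differentiable_mult[OF lam]) simp_all
  have "?f q = a i q" if q: "q \<in> U" for q
  proof -
    have "(\<Sum>j\<in>UNIV. \<Sum>k\<in>UNIV. g' j k q * L i j k q) = lam q * mean_cartan F i q
        + (\<Sum>j\<in>UNIV. \<Sum>k\<in>UNIV. g' j k q * (a i q * h j k q + a j q * h k i q + a k q * h i j q))"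
      by (simp add: L[OF q] mean_cartan_def sum_distrib_left distrib_left sum.distrib mult_ac)
    then show ?thesis using angular_trace[OF q, of "\<lambda>i. a i q" i] by (simp add: ay[OF q])
  qed
  then show ?thesis
    using d p has_derivative_transform_within_open[of ?f _ p UNIV U "a i"] open_U
    unfolding differentiable_def by blast
qed

theorem matsumoto_eq_0:
  assumes p: "p \<in> U"
    and lam: "\<And>q. q \<in> U \<Longrightarrow> lam differentiable (at q)"
    and L: "\<And>q i j k. q \<in> U \<Longrightarrow> landsberg F i j k q =
      lam q * C i j k q + a i q * h j k q + a j q * h k i q + a k q * h i j q"
    and ay: "\<And>q. q \<in> U \<Longrightarrow> (\<Sum>i\<in>UNIV. a i q * snd q $ i) = 0"
    and K: "\<And>q u. q \<in> U \<Longrightarrow> u \<notin> span {snd q} \<Longrightarrow> flag_curvature F q u = K q"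
    and nz: "(\<Sum>l\<in>UNIV. delta F l lam p * snd p $ l) + (lam p)\<^sup>2 + K p * (F p)\<^sup>2 \<noteq> 0"
  shows "matsumoto F i j k p = 0"
proof (cases "CARD('n) = 1")
  case True
  then show ?thesis by (rule matsumoto_eq_0_dim_1[OF p])
next
  case False
  then have n: "CARD('n) \<ge> 2"
    using zero_less_card_finite[where 'a = 'n] by linarith
  have L': "L i j k q = lam q * C i j k q + a i q * h j k q + a j q * h k i q + a k q * h i j q"
    if "q \<in> U" for q i j k
    using L[OF that] landsberg_eq[OF that] by simp
  have a: "a i differentiable (at p)" for i
    using differentiable_of_trace[OF p lam[OF p] L' ay] .
  have sK: "smooth_on K U" using scalar_flag_curvature_smooth[OF n K] .
  define Da where "Da i = S (a i) p - (\<Sum>s\<in>UNIV. N s i p * a s p)" for i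
  \<comment> \<open>This is the quantity assumed to be nonzero, with the contracted horizontal
    derivative of \<open>lam\<close> written as \<open>S lam p\<close> and the square of
    \<open>F\<close> as \<open>2 * E\<close>.\<close>
  define m where "m = S lam p + (lam p)\<^sup>2 + 2 * E p * K p"
  have "m \<noteq> 0"
    using nz unfolding S_delta[OF p lam[OF p]] m_def E_def by (simp add: mult.commute)
  \<comment> \<open>The total coefficient of the angular terms: \<open>Da\<close> from
    differentiating \<open>a\<close>, \<open>lam p * a i p\<close> from expanding
    \<open>lam p * L\<close>, and the last summand from the flag curvature.\<close>
  define b where "b i = Da i + lam p * a i p + 2/3 * E p * dy i K p" for i
  have mC: "m * C i j k p = - (b i * h j k p + b j * h k i p + b k * h i j p)" for i j k
    using D3_generalized_P_reducible[OF p lam[OF p] a L', of i j k, folded Da_def]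
      D3_landsberg_scalar_flag[OF p sK K, of i j k] L'[OF p, of i j k]
    by (simp add: m_def b_def power2_eq_square algebra_simps)
  show ?thesis
  proof (rule matsumoto_eq_0I[OF p, where c = "\<lambda>i. - b i / m"])
    show "C i j k p = - b i / m * h j k p + - b j / m * h k i p + - b k / m * h i j p" for i j k
      using nonzero_mult_div_cancel_left[OF \<open>m \<noteq> 0\<close>, of "C i j k p", unfolded mC]
      by (simp add: diff_divide_distrib)
  qed
qed

end

section \<open>Passage from single charts to the manifold\<close>

theorem theorem1p1:
  fixes X :: "'m topology" and A :: "('m, 'n::finite) chart set"
    and F lam K :: "('m, 'n) tvec \<Rightarrow> real"
    and a :: "('m, 'n) tvec \<Rightarrow> ('m, 'n) tvec \<Rightarrow> real"
  assumes "smooth_manifold X A"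
    and "finsler_metric A F"
    and "generalized_P_reducible A F lam a"
    and "\<forall>c\<in>A. \<forall>p\<in>slit_dom c. coord A c lam differentiable (at p)"
    and "scalar_flag_curvature A F K"
    and "\<exists>w\<in>slit_tangent_bundle A. K w \<noteq> 0"
    and "\<forall>c\<in>A. \<forall>p\<in>slit_dom c.
           (\<Sum>l\<in>UNIV. delta (coord A c F) l (coord A c lam) p * snd p $ l)
           + (coord A c lam p)\<^sup>2 + coord A c K p * (coord A c F p)\<^sup>2 \<noteq> 0"
  shows "C_reducible A F"
  unfolding C_reducible_def
proof (intro ballI allI)
  fix c p i j k assume c: "c \<in> A" and p: "p \<in> slit_dom c"
  \<comment> \<open>C-reducibility is a condition on the coordinate representations, so one instance
    of the local theory for each chart of the atlas suffices.\<close>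
  interpret finsler_chart "coord A c F" "snd c ` fst c"
  proof
    show "open (snd c ` fst c)"
      using assms(1) c by (simp add: smooth_manifold_def chart_on_def)
    show "smooth_on (coord A c F) (snd c ` fst c \<times> (UNIV - {0}))"
      using assms(2) c by (simp add: finsler_metric_def slit_dom_def)
    show "coord A c F (x, t *\<^sub>R y) = t * coord A c F (x, y)"
      if "x \<in> snd c ` fst c" "y \<noteq> 0" "t > 0" for x y t
    proof -
      have "pos_homogeneous A 1 F" using assms(2) by (simp add: finsler_metric_def)
      then have "coord A c F (x, t *\<^sub>R y) = t ^ 1 * coord A c F (x, y)"
        using c that unfolding pos_homogeneous_def by blast
      then show ?thesis by simp
    qed
    show "fund_form (coord A c F) p u u > 0"
      if "p \<in> snd c ` fst c \<times> (UNIV - {0})" "u \<noteq> 0" for p u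
      using assms(2) c that unfolding finsler_metric_def slit_dom_def by blast
  qed
  have U: "U = slit_dom c" by (simp add: U_def slit_dom_def)
  show "matsumoto (coord A c F) i j k p = 0"
  proof (rule matsumoto_eq_0[unfolded U, where lam = "coord A c lam" and a = "coord_cov A c a" and K = "coord A c K"])
  qed (use assms c p in \<open>auto simp: generalized_P_reducible_def scalar_flag_curvature_def\<close>)
qed

end
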